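(* Let $S$ be a discrete (countable) set and let $(Y_n)_{n\ge0}$ be a partially exchangeable sequence of $S$-valued random variables with $\mathbb P(Y_0=y_0)=1$ for some $y_0\in S$. Then $(Y_n)$ is a countable mixture of Markov chains if and only if $(Y_n)$ is a hidden Markov model with recurrent underlying Markov chain.
   Context: "Countable" includes finite. Let $\partial\notin S$ and $S^*=S\cup\{\partial\}$. Successors array: for $y\in S$, $n\ge1$, $V_{y,n}$ is the value of $Y$ immediately following the $n$-th visit of $Y$ to $y$ (visits counted from time $0$). If $Y$ visits $y$ only $m<\infty$ times, $V_{y,n}=\partial$ for all $n>m$. Partial exchangeability: $(Y_n)$ is partially exchangeable if the law of $V=(V_{y,n})_{y\in S,n\ge1}$ is invariant under finite, not necessarily identical, permutations within each of its rows $(V_{y,n})_{n\ge1}$. Mixtures of Markov chains: $(Y_n)$ with $\mathbb P(Y_0=y_0)=1$ is a mixture of Markov chains if there is a random matrix $\widetilde P=(\widetilde P_{i,j})_{i,j\in S^*}$ with values in the set of transition (stochastic) matrices on $S^*$ such that, for all $N\in\mathbb N$ and all $y_1,\dots,y_N\in S^*$, $\mathbb P(Y_1=y_1,\dots,Y_N=y_N\mid\widetilde P)=\widetilde P_{y_0y_1}\widetilde P_{y_1y_2}\cdots\widetilde P_{y_{N-1}y_N}$ $\mathbb P$-a.s. The mixture is countable if $\widetilde P$ is countably valued, i.e. concentrated on a countable family $(P^h)_{h\in H}$ of transition matrices. Hidden Markov model (HMM): $(Y_n)_{n\ge0}$ is an HMM if there is a pair of processes $(X_n,\widetilde Y_n)_{n\ge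 0}$ with values in $\mathcal X\times S$, $\mathcal X$ a discrete (countable) space, such that (1) $(X_n)$ is a time homogeneous Markov chain on $\mathcal X$ (the underlying Markov chain); (2) for all $N$ and $S_0,\dots,S_N\subseteq S$, $\mathbb P(\widetilde Y_0\in S_0,\dots,\widetilde Y_N\in S_N\mid X_0^N=x_0^N)=\prod_{n=0}^N\mathbb P(\widetilde Y_n\in S_n\mid X_n=x_n)$, where the read-out distributions $f_x(\bar S)=\mathbb P(\widetilde Y_n\in\bar S\mid X_n=x)$ do not depend on $n$; (3) $(Y_n)$ and $(\widetilde Y_n)$ have the same finite-dimensional distributions. Recurrence: a time homogeneous Markov chain $(X_n)_{n\ge 0}$ is called recurrent if $\mathbb P(X_n=x\text{ for infinitely many }n\mid X_1=x)=1$ for all $x\in\mathcal X$ such that $\mathbb P(X_1=x)>0$. *)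

theory Defs
  imports "HOL-Probability.Probability" "HOL-Combinatorics.Permutations"
begin

text \<open>
  The countable set \<open>S\<close> is a type \<open>'s\<close> of class \<open>countable\<close>; \<open>S\<^sup>*\<close> is \<open>'s option\<close>, with
  \<open>None\<close> in the role of the extra point.
\<close>

text \<open>
  Row entries are indexed from \<open>0\<close>: \<open>successors Y \<omega> (y, n)\<close> is the value that follows visit number
  \<open>n + 1\<close> of the path to \<open>y\<close>.
\<close>

definition successors :: "(nat \<Rightarrow> 'a \<Rightarrow> 's) \<Rightarrow> 'a \<Rightarrow> 's \<times> nat \<Rightarrow> 's option" where
  "successors Y \<omega> = (\<lambda>(y, n).
     let visits = {k. Y k \<omega> = y} in
     if finite visits \<and> card visits \<le> n then None
     else Some (Y (Suc (enumerate visits n)) \<omega>))"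

definition partially_exchangeable :: "'a measure \<Rightarrow> (nat \<Rightarrow> 'a \<Rightarrow> 's) \<Rightarrow> bool" where
  "partially_exchangeable M Y \<longleftrightarrow>
     (\<forall>\<pi> :: 's \<Rightarrow> nat \<Rightarrow> nat. (\<forall>y. \<exists>F. finite F \<and> \<pi> y permutes F) \<longrightarrow>
        distr M (\<Pi>\<^sub>M _\<in>UNIV. count_space UNIV) (\<lambda>\<omega> (y, n). successors Y \<omega> (y, \<pi> y n))
        = distr M (\<Pi>\<^sub>M _\<in>UNIV. count_space UNIV) (successors Y))"

definition transition_matrix :: "('i \<Rightarrow> 'i \<Rightarrow> real) \<Rightarrow> bool" where
  "transition_matrix P \<longleftrightarrow> (\<forall>i. (\<forall>j. 0 \<le> P i j) \<and> (P i has_sum 1) UNIV)"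

abbreviation matrix_space :: "('i \<Rightarrow> 'i \<Rightarrow> real) measure" where
  "matrix_space \<equiv> (\<Pi>\<^sub>M _\<in>UNIV. \<Pi>\<^sub>M _\<in>UNIV. borel)"

text \<open>
  Conditioning on the random matrix is conditioning on the sigma-algebra that it generates. The
  index \<open>y 0\<close> is the starting point \<open>y\<^sub>0\<close>; the entries \<open>y 1, \<dots>, y N\<close> range over all of \<open>S\<^sup>*\<close>.
\<close>

definition markov_mixture_by ::
  "'a measure \<Rightarrow> (nat \<Rightarrow> 'a \<Rightarrow> 's) \<Rightarrow> 's \<Rightarrow> ('a \<Rightarrow> 's option \<Rightarrow> 's option \<Rightarrow> real) \<Rightarrow> bool" where
  "markov_mixture_by M Y y\<^sub>0 P \<longleftrightarrow>
     P \<in> measurable M matrix_space \<and>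
     (\<forall>\<omega>\<in>space M. transition_matrix (P \<omega>)) \<and>
     (\<forall>N (y :: nat \<Rightarrow> 's option). y 0 = Some y\<^sub>0 \<longrightarrow>
        (AE \<omega> in M.
           real_cond_exp M (vimage_algebra (space M) P matrix_space)
             (indicator {\<omega> \<in> space M. \<forall>n\<in>{1..N}. Some (Y n \<omega>) = y n}) \<omega>
           = (\<Prod>n<N. P \<omega> (y n) (y (Suc n)))))"

definition countable_markov_mixture :: "'a measure \<Rightarrow> (nat \<Rightarrow> 'a \<Rightarrow> 's) \<Rightarrow> 's \<Rightarrow> bool" where
  "countable_markov_mixture M Y y\<^sub>0 \<longleftrightarrow>
     (\<exists>P. markov_mixture_by M Y y\<^sub>0 P \<and>
        (\<exists>H. countable H \<and> (\<forall>Q\<in>H. transition_matrix Q) \<and> (AE \<omega> in M. P \<omega> \<in> H)))"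

definition homogeneous_markov_chain :: "'b measure \<Rightarrow> (nat \<Rightarrow> 'b \<Rightarrow> 'x) \<Rightarrow> bool" where
  "homogeneous_markov_chain Q X \<longleftrightarrow>
     (\<forall>n. X n \<in> measurable Q (count_space UNIV)) \<and>
     (\<forall>n x j. \<P>(\<omega> in Q. \<forall>i\<le>n. X i \<omega> = x i) > 0 \<longrightarrow>
        \<P>(\<omega> in Q. X (Suc n) \<omega> = j \<bar> \<forall>i\<le>n. X i \<omega> = x i)
        = \<P>(\<omega> in Q. X (Suc n) \<omega> = j \<bar> X n \<omega> = x n)) \<and>
     (\<forall>m n i j. \<P>(\<omega> in Q. X m \<omega> = i) > 0 \<longrightarrow> \<P>(\<omega> in Q. X n \<omega> = i) > 0 \<longrightarrow>
        \<P>(\<omega> in Q. X (Suc m) \<omega> = j \<bar> X m \<omega> = i)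
        = \<P>(\<omega> in Q. X (Suc n) \<omega> = j \<bar> X n \<omega> = i))"

definition recurrent_chain :: "'b measure \<Rightarrow> (nat \<Rightarrow> 'b \<Rightarrow> 'x) \<Rightarrow> bool" where
  "recurrent_chain Q X \<longleftrightarrow>
     (\<forall>x. \<P>(\<omega> in Q. X 1 \<omega> = x) > 0 \<longrightarrow>
        \<P>(\<omega> in Q. (\<exists>\<^sub>\<infinity>n. X n \<omega> = x) \<bar> X 1 \<omega> = x) = 1)"

definition hmm_representation ::
  "'a measure \<Rightarrow> (nat \<Rightarrow> 'a \<Rightarrow> 's) \<Rightarrow>
   'b measure \<Rightarrow> (nat \<Rightarrow> 'b \<Rightarrow> 'x) \<Rightarrow> (nat \<Rightarrow> 'b \<Rightarrow> 's) \<Rightarrow> bool" where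
  "hmm_representation M Y Q X Z \<longleftrightarrow>
     prob_space Q \<and>
     homogeneous_markov_chain Q X \<and>
     (\<forall>n. Z n \<in> measurable Q (count_space UNIV)) \<and>
     (\<forall>N x A. \<P>(\<omega> in Q. \<forall>n\<le>N. X n \<omega> = x n) > 0 \<longrightarrow>
        \<P>(\<omega> in Q. (\<forall>n\<le>N. Z n \<omega> \<in> A n) \<bar> \<forall>n\<le>N. X n \<omega> = x n)
        = (\<Prod>n\<le>N. \<P>(\<omega> in Q. Z n \<omega> \<in> A n \<bar> X n \<omega> = x n))) \<and>
     (\<forall>m n x A. \<P>(\<omega> in Q. X m \<omega> = x) > 0 \<longrightarrow> \<P>(\<omega> in Q. X n \<omega> = x) > 0 \<longrightarrow>
        \<P>(\<omega> in Q. Z m \<omega> \<in> A \<bar> X m \<omega> = x) = \<P>(\<omega> in Q. Z n \<omega> \<in> A \<bar> X n \<omega> = x)) \<and>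
     (\<forall>J. finite J \<longrightarrow>
        distr M (\<Pi>\<^sub>M _\<in>J. count_space UNIV) (\<lambda>\<omega>. \<lambda>n\<in>J. Y n \<omega>)
        = distr Q (\<Pi>\<^sub>M _\<in>J. count_space UNIV) (\<lambda>\<omega>. \<lambda>n\<in>J. Z n \<omega>))"

text \<open>
  A definition cannot quantify over types, so the hidden state space is \<open>nat\<close> and the hidden pair
  lives on a probability measure on sequences in \<open>nat \<times> 's\<close>. The lemma \<open>recurrent_hmmI\<close> below
  shows that this is no restriction: every representation with an arbitrary countable hidden state
  space over an arbitrary probability space gives one of this form.
\<close>

definition recurrent_hmm :: "'a measure \<Rightarrow> (nat \<Rightarrow> 'a \<Rightarrow> 's) \<Rightarrow> bool" where
  "recurrent_hmm M Y \<longleftrightarrow>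
     (\<exists>(Q :: (nat \<Rightarrow> nat \<times> 's) measure) (X :: nat \<Rightarrow> (nat \<Rightarrow> nat \<times> 's) \<Rightarrow> nat) Z.
        hmm_representation M Y Q X Z \<and> recurrent_chain Q X)"

lemma recurrent_hmmI:
  fixes Y :: "nat \<Rightarrow> 'a \<Rightarrow> 's::countable" and X :: "nat \<Rightarrow> 'b \<Rightarrow> 'x::countable"
  assumes rep: "hmm_representation M Y Q X Z" and rec: "recurrent_chain Q X"
  shows "recurrent_hmm M Y"
proof -
  interpret Q: prob_space Q using rep by (simp add: hmm_representation_def)
  have [measurable]: "X n \<in> measurable Q (count_space UNIV)"
    "Z n \<in> measurable Q (count_space UNIV)" for n
    using rep by (simp_all add: hmm_representation_def homogeneous_markov_chain_def)
  define W :: "'b \<Rightarrow> nat \<Rightarrow> nat \<times> 's" where "W = (\<lambda>\<omega> n. (to_nat (X n \<omega>), Z n \<omega>))"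
  let ?S = "(\<Pi>\<^sub>M _\<in>UNIV. count_space UNIV) :: (nat \<Rightarrow> nat \<times> 's) measure"
  define R where "R = distr Q ?S W"
  define X' where "X' = (\<lambda>n (w :: nat \<Rightarrow> nat \<times> 's). fst (w n))"
  define Z' where "Z' = (\<lambda>n (w :: nat \<Rightarrow> nat \<times> 's). snd (w n))"
  have W [measurable]: "W \<in> measurable Q ?S"
  proof (unfold W_def, rule measurable_PiM_single')
    fix n :: nat
    have "(\<lambda>\<omega>. (to_nat (X n \<omega>), Z n \<omega>)) \<in> measurable Q (count_space UNIV \<Otimes>\<^sub>M count_space UNIV)"
      by measurable
    then show "(\<lambda>\<omega>. (to_nat (X n \<omega>), Z n \<omega>)) \<in> measurable Q (count_space UNIV)"
      by (simp add: pair_measure_countable)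
  qed auto
  have setsR [measurable_cong]: "sets R = sets ?S" by (simp add: R_def)
  have comp: "(\<lambda>w. w n) \<in> measurable ?S (count_space UNIV)" for n :: nat
    by (rule measurable_component_singleton) simp
  have [measurable]: "X' n \<in> measurable ?S (count_space UNIV)"
    "Z' n \<in> measurable ?S (count_space UNIV)" for n
    unfolding X'_def Z'_def
    by (rule measurable_compose[OF comp], simp)+
  have XW: "X' n (W \<omega>) = to_nat (X n \<omega>)" and ZW: "Z' n (W \<omega>) = Z n \<omega>" for n \<omega>
    by (simp_all add: X'_def Z'_def W_def)
  have prob: "\<P>(w in R. A w) = \<P>(\<omega> in Q. A (W \<omega>))" if "Measurable.pred ?S A" for A
  proof -
    have "{w \<in> space ?S. A w} \<in> sets ?S" using that by simp
    then show ?thesis unfolding R_def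
      by (subst measure_distr[OF W])
        (auto intro!: arg_cong[where f="measure Q"] simp: space_PiM)
  qed
  have cond: "\<P>(w in R. A w \<bar> B w) = \<P>(\<omega> in Q. A (W \<omega>) \<bar> B (W \<omega>))"
    if [measurable]: "Measurable.pred ?S A" "Measurable.pred ?S B" for A B
    by (simp add: cond_prob_def prob)
  have pos1: "\<exists>y::'x. x = to_nat y" if "\<P>(\<omega> in Q. to_nat (X n \<omega>) = x) > 0" for n x
  proof (rule ccontr)
    assume "\<nexists>y::'x. x = to_nat y"
    then have "{\<omega> \<in> space Q. to_nat (X n \<omega>) = x} = {}" by auto
    with that show False by simp
  qed
  have posN: "\<exists>y::nat \<Rightarrow> 'x. \<forall>i\<le>N. x i = to_nat (y i)" if "\<P>(\<omega> in Q. \<forall>i\<le>N. to_nat (X i \<omega>) = x i) > 0" for N x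
  proof -
    have "{\<omega> \<in> space Q. \<forall>i\<le>N. to_nat (X i \<omega>) = x i} \<noteq> {}" using that by (metis measure_empty less_irrefl)
    then obtain \<omega> where "\<forall>i\<le>N. to_nat (X i \<omega>) = x i" by auto
    then show ?thesis by (intro exI[of _ "\<lambda>i. X i \<omega>"]) auto
  qed
  have MX: "homogeneous_markov_chain Q X" using rep by (simp add: hmm_representation_def)
  have "homogeneous_markov_chain R X'"
    unfolding homogeneous_markov_chain_def
  proof (intro conjI allI impI)
    show "X' n \<in> measurable R (count_space UNIV)" for n by measurable
  next
    fix n x j assume p: "\<P>(w in R. \<forall>i\<le>n. X' i w = x i) > 0"
    then have p': "\<P>(\<omega> in Q. \<forall>i\<le>n. to_nat (X i \<omega>) = x i) > 0" by (simp add: prob XW)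
    obtain y :: "nat \<Rightarrow> 'x" where y: "\<forall>i\<le>n. x i = to_nat (y i)" using posN[OF p'] by blast
    have e: "(\<forall>i\<le>n. to_nat (X i \<omega>) = x i) \<longleftrightarrow> (\<forall>i\<le>n. X i \<omega> = y i)"
      "(to_nat (X n \<omega>) = x n) \<longleftrightarrow> X n \<omega> = y n" for \<omega> using y by auto
    show "\<P>(w in R. X' (Suc n) w = j \<bar> \<forall>i\<le>n. X' i w = x i) = \<P>(w in R. X' (Suc n) w = j \<bar> X' n w = x n)"
    proof (cases "\<exists>k. j = to_nat (k::'x)")
      case True
      then obtain k where "j = to_nat (k::'x)" by blast
      then show ?thesis using MX p'
        by (simp add: cond XW e homogeneous_markov_chain_def)
    next
      case False
      then have "to_nat (X (Suc n) \<omega>) \<noteq> j" for \<omega> by auto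
      then show ?thesis by (simp add: cond XW) (simp add: cond_prob_def)
    qed
  next
    fix m n i j assume "\<P>(w in R. X' m w = i) > 0" "\<P>(w in R. X' n w = i) > 0"
    then have p: "\<P>(\<omega> in Q. to_nat (X m \<omega>) = i) > 0" "\<P>(\<omega> in Q. to_nat (X n \<omega>) = i) > 0"
      by (simp_all add: prob XW)
    then obtain y where y: "i = to_nat (y::'x)" using pos1 p by blast
    show "\<P>(w in R. X' (Suc m) w = j \<bar> X' m w = i) = \<P>(w in R. X' (Suc n) w = j \<bar> X' n w = i)"
    proof (cases "\<exists>k. j = to_nat (k::'x)")
      case True
      then obtain k where k: "j = to_nat (k::'x)" by blast
      have "\<P>(\<omega> in Q. X (Suc m) \<omega> = k \<bar> X m \<omega> = y) = \<P>(\<omega> in Q. X (Suc n) \<omega> = k \<bar> X n \<omega> = y)"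
        using MX p unfolding y homogeneous_markov_chain_def inj_eq[OF inj_to_nat] by blast
      then show ?thesis by (simp add: cond XW y k)
    next
      case False
      then have "to_nat (X n \<omega>) \<noteq> j" for n \<omega> by auto
      then show ?thesis by (simp add: cond XW) (simp add: cond_prob_def)
    qed
  qed
  moreover have "prob_space R" unfolding R_def by (rule Q.prob_space_distr[OF W])
  moreover have "Z' n \<in> measurable R (count_space UNIV)" for n by measurable
  moreover have "\<P>(w in R. (\<forall>n\<le>N. Z' n w \<in> A n) \<bar> \<forall>n\<le>N. X' n w = x n)
        = (\<Prod>n\<le>N. \<P>(w in R. Z' n w \<in> A n \<bar> X' n w = x n))"
    if "\<P>(w in R. \<forall>n\<le>N. X' n w = x n) > 0" for N x A
  proof -
    have p': "\<P>(\<omega> in Q. \<forall>i\<le>N. to_nat (X i \<omega>) = x i) > 0" using that by (simp add: prob XW)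
    obtain y :: "nat \<Rightarrow> 'x" where y: "\<forall>i\<le>N. x i = to_nat (y i)" using posN[OF p'] by blast
    have e: "(\<forall>i\<le>N. to_nat (X i \<omega>) = x i) \<longleftrightarrow> (\<forall>i\<le>N. X i \<omega> = y i)" for \<omega> using y by auto
    have "\<P>(\<omega> in Q. (\<forall>n\<le>N. Z n \<omega> \<in> A n) \<bar> \<forall>n\<le>N. X n \<omega> = y n)
        = (\<Prod>n\<le>N. \<P>(\<omega> in Q. Z n \<omega> \<in> A n \<bar> X n \<omega> = y n))"
      using rep p' unfolding e hmm_representation_def by blast
    also have "\<dots> = (\<Prod>n\<le>N. \<P>(w in R. Z' n w \<in> A n \<bar> X' n w = x n))"
      using y by (intro prod.cong) (simp_all add: cond XW ZW)
    finally show ?thesis by (simp add: cond XW ZW e)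
  qed
  moreover have "\<P>(w in R. Z' m w \<in> A \<bar> X' m w = x) = \<P>(w in R. Z' n w \<in> A \<bar> X' n w = x)"
    if "\<P>(w in R. X' m w = x) > 0" "\<P>(w in R. X' n w = x) > 0" for m n x A
  proof -
    have p: "\<P>(\<omega> in Q. to_nat (X m \<omega>) = x) > 0" "\<P>(\<omega> in Q. to_nat (X n \<omega>) = x) > 0"
      using that by (simp_all add: prob XW)
    then obtain y where y: "x = to_nat (y::'x)" using pos1 p by blast
    have "\<P>(\<omega> in Q. Z m \<omega> \<in> A \<bar> X m \<omega> = y) = \<P>(\<omega> in Q. Z n \<omega> \<in> A \<bar> X n \<omega> = y)"
      using rep p unfolding y hmm_representation_def inj_eq[OF inj_to_nat] by blast
    then show ?thesis by (simp add: cond XW ZW y)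
  qed
  moreover have "distr M (\<Pi>\<^sub>M _\<in>J. count_space UNIV) (\<lambda>\<omega>. \<lambda>n\<in>J. Y n \<omega>)
        = distr R (\<Pi>\<^sub>M _\<in>J. count_space UNIV) (\<lambda>w. \<lambda>n\<in>J. Z' n w)" if "finite J" for J
  proof -
    have "(\<lambda>w. \<lambda>n\<in>J. Z' n w) \<in> measurable ?S (\<Pi>\<^sub>M _\<in>J. count_space UNIV)"
      by measurable
    then have "distr R (\<Pi>\<^sub>M _\<in>J. count_space UNIV) (\<lambda>w. \<lambda>n\<in>J. Z' n w)
      = distr Q (\<Pi>\<^sub>M _\<in>J. count_space UNIV) (\<lambda>\<omega>. \<lambda>n\<in>J. Z n \<omega>)"
      unfolding R_def by (subst distr_distr[OF _ W]) (simp_all add: comp_def ZW)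
    with rep that show ?thesis by (simp add: hmm_representation_def)
  qed
  ultimately have "hmm_representation M Y R X' Z'"
    unfolding hmm_representation_def by blast
  moreover have "recurrent_chain R X'"
    unfolding recurrent_chain_def
  proof (intro allI impI)
    fix x assume "\<P>(w in R. X' 1 w = x) > 0"
    then have p: "\<P>(\<omega> in Q. to_nat (X 1 \<omega>) = x) > 0" by (simp add: prob XW)
    then obtain y where y: "x = to_nat (y::'x)" using pos1 p by blast
    have "Measurable.pred ?S (\<lambda>w. \<exists>\<^sub>\<infinity>n. X' n w = x)"
      unfolding INFM_nat by measurable
    moreover have "\<P>(\<omega> in Q. (\<exists>\<^sub>\<infinity>n. X n \<omega> = y) \<bar> X 1 \<omega> = y) = 1"
      using rec p unfolding y recurrent_chain_def inj_eq[OF inj_to_nat] by blast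
    ultimately show "\<P>(w in R. (\<exists>\<^sub>\<infinity>n. X' n w = x) \<bar> X' 1 w = x) = 1"
      by (simp add: cond XW y)
  qed
  ultimately show ?thesis unfolding recurrent_hmm_def by blast
qed

end

theory Submission
  imports Defs
begin

text \<open>
  A partially exchangeable path visits every state never or infinitely often: a finite row of
  successors, permuted, would have a gap. Hence, if the sequence is a mixture over countably many
  matrices, the pair (index of the matrix, current state) is a recurrent Markov chain of which the
  sequence is a function.

  Conversely, the frequencies in the rows of the successors array converge almost surely along the
  times \<open>4 ^ k\<close>, and exchangeability turns the limits into a random transition matrix given which the
  array has independent entries; this is de Finetti's theorem for arrays. The limits do not change
  when the path is shifted. In a recurrent chain the path regenerates at each return to the state \<open>x\<close>
  of time \<open>1\<close>, so a shift invariant event is independent of every finite initial segment given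
  \<open>X\<^sub>1 = x\<close>, and therefore has conditional probability \<open>0\<close> or \<open>1\<close>. The random matrix is thus almost
  surely a function of \<open>X\<^sub>1\<close>, which has countably many values.
\<close>

section \<open>Successors arrays\<close>

text \<open>The random matrix is a function of the path of Y, while the hidden chain lives on
  another space and is tied to Y only through finite-dimensional laws. Countable valuedness
  therefore has to travel as the probability of one measurable set of paths. Nothing makes the
  hidden chain irreducible, and its state at time 0 may be transient. So no invariant event need be
  trivial outright, only given the state at time 1; this suffices because limiting frequencies
  ignore initial segments. The invariances of the limits, under swaps in a row and under the shift,
  hold for every array and every path. They stay valid where no limit exists, because
  \<open>lim\<close> is total and cannot tell apart sequences whose difference tends to 0. They can
  thus be used inside integrals and for invariant sets without exceptional null sets. The value
  \<open>None\<close> is treated as one more symbol of the array. The de Finetti argument then needs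
  no case distinction on rows: the row of a state that is never visited consists of
  \<open>None\<close> only, and its limit is the unit mass at \<open>None\<close>.\<close>

lemma card_below_enumerate:
  fixes S :: "nat set"
  assumes "infinite S \<or> n < card S"
  shows "card {i \<in> S. i < enumerate S n} = n"
proof -
  have inS: "enumerate S m \<in> S" if "m \<le> n" for m
    using assms that by (cases "finite S") (auto intro: enumerate_in_set finite_enumerate_in_set)
  have mono: "enumerate S m < enumerate S m' \<longleftrightarrow> m < m'"
    if "infinite S \<or> m < card S" "infinite S \<or> m' < card S" for m m'
    using that by (cases "finite S") auto
  have "{i \<in> S. i < enumerate S n} = enumerate S ` {..<n}"
  proof (intro equalityI subsetI)
    fix i assume i: "i \<in> {i \<in> S. i < enumerate S n}"
    obtain m where m: "i = enumerate S m" "infinite S \<or> m < card S"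
      using i enumerate_Ex[of S i] finite_enumerate_Ex[of S i] by (cases "finite S") auto
    with i mono[OF m(2) assms] show "i \<in> enumerate S ` {..<n}" by auto
  next
    fix i assume "i \<in> enumerate S ` {..<n}"
    then obtain m where m: "m < n" "i = enumerate S m" by auto
    then show "i \<in> {i \<in> S. i < enumerate S n}"
      using inS[of m] mono[of m n] assms by auto
  qed
  moreover have "inj_on (enumerate S) {..<n}"
  proof (rule inj_onI)
    fix a b assume "a \<in> {..<n}" "b \<in> {..<n}" "enumerate S a = enumerate S b"
    then show "a = b" using mono[of a b] mono[of b a] assms by (metis lessThan_iff less_trans linorder_neqE_nat less_irrefl)
  qed
  ultimately show ?thesis by (simp add: card_image)
qed

text \<open>Trades \<open>enumerate\<close> for a count of earlier visits. The condition at a given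
  time then involves only the path up to the next step, which is what measurability, the shift and
  the reading of a path off the array all rest on.\<close>

lemma successors_eq_Some_iff:
  "successors Y \<omega> (y, n) = Some z \<longleftrightarrow>
     (\<exists>k. Y k \<omega> = y \<and> card {i. i < k \<and> Y i \<omega> = y} = n \<and> Y (Suc k) \<omega> = z)"
proof -
  define S where "S = {k. Y k \<omega> = y}"
  have card_eq: "card {i. i < k \<and> Y i \<omega> = y} = card {i \<in> S. i < k}" for k
    by (rule arg_cong[where f=card]) (auto simp: S_def)
  have "(\<exists>k. k \<in> S \<and> card {i \<in> S. i < k} = n \<and> Y (Suc k) \<omega> = z) \<longleftrightarrow>
    (infinite S \<or> n < card S) \<and> Y (Suc (enumerate S n)) \<omega> = z" (is "?L \<longleftrightarrow> ?R")
  proof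
    assume ?L
    then obtain k where k: "k \<in> S" "card {i \<in> S. i < k} = n" "Y (Suc k) \<omega> = z" by auto
    obtain m where m: "k = enumerate S m" "infinite S \<or> m < card S"
      using k(1) enumerate_Ex[of S k] finite_enumerate_Ex[of S k] by (cases "finite S") auto
    have "m = n" using card_below_enumerate[OF m(2)] k(2) m(1) by simp
    then show ?R using m k by auto
  next
    assume R: ?R
    have "enumerate S n \<in> S"
      using R by (cases "finite S") (auto intro: enumerate_in_set finite_enumerate_in_set)
    then show ?L using R card_below_enumerate by blast
  qed
  then show ?thesis
    by (simp add: successors_def Let_def card_eq flip: S_def) (auto simp: S_def not_le)
qed

text \<open>The array sees \<omega> only through its path, so facts about the coordinate process on
  sequences carry over to every process.\<close>

lemma successors_path: "successors Y \<omega> = successors (\<lambda>n w. w n) (\<lambda>n. Y n \<omega>)"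
  by (simp add: successors_def)

lemma successors_at_visit:
  "successors Y \<omega> (Y k \<omega>, card {i. i < k \<and> Y i \<omega> = Y k \<omega>}) = Some (Y (Suc k) \<omega>)"
  by (subst successors_eq_Some_iff) auto

lemma measurable_card_visits [measurable]:
  fixes Y :: "nat \<Rightarrow> 'a \<Rightarrow> 's::countable"
  assumes [measurable]: "\<And>n. Y n \<in> measurable M (count_space UNIV)"
  shows "(\<lambda>\<omega>. card {i. i < k \<and> Y i \<omega> = y}) \<in> measurable M (count_space UNIV)"
proof -
  have "{i. i < k \<and> Y i \<omega> = y} = {..<k} \<inter> {i. Y i \<omega> = y}" for \<omega> by auto
  then have "card {i. i < k \<and> Y i \<omega> = y} = (\<Sum>i<k. if Y i \<omega> = y then 1 else 0)" for \<omega>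
    by (simp add: sum.If_cases)
  moreover have "(\<lambda>\<omega>. \<Sum>i<k. if Y i \<omega> = y then 1 else 0 :: nat) \<in> measurable M (count_space UNIV)"
    by measurable
  ultimately show ?thesis by presburger
qed

lemma measurable_successors [measurable]:
  fixes Y :: "nat \<Rightarrow> 'a \<Rightarrow> 's::countable"
  assumes [measurable]: "\<And>n. Y n \<in> measurable M (count_space UNIV)"
  shows "successors Y \<in> measurable M (\<Pi>\<^sub>M _\<in>UNIV. count_space UNIV)"
proof (rule measurable_PiM_single')
  fix p :: "'s \<times> nat"
  obtain y n where p: "p = (y, n)" by (cases p)
  have some: "{\<omega> \<in> space M. successors Y \<omega> p = Some z} \<in> sets M" for z
    unfolding p successors_eq_Some_iff by measurable
  have "{\<omega> \<in> space M. successors Y \<omega> p = v} \<in> sets M" for v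
  proof (cases v)
    case None
    have "{\<omega> \<in> space M. successors Y \<omega> p = v} =
      space M - (\<Union>z. {\<omega> \<in> space M. successors Y \<omega> p = Some z})"
      unfolding None by auto
    then show ?thesis using some by (auto intro!: sets.Diff sets.countable_UN'')
  qed (simp add: some)
  moreover have "(\<lambda>\<omega>. successors Y \<omega> p) -` {v} \<inter> space M = {\<omega> \<in> space M. successors Y \<omega> p = v}" for v
    by auto
  ultimately show "(\<lambda>\<omega>. successors Y \<omega> p) \<in> measurable M (count_space UNIV)"
    by (simp add: measurable_count_space_eq2_countable)
qed auto

text \<open>The shift forgets a single visit, the one at time 0. One row loses its leading entry and
  the others are untouched, a change that long averages do not notice.\<close>

lemma successors_shift:
  "successors (\<lambda>n w. w n) (\<lambda>n. w (Suc n)) (y, n)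
    = successors (\<lambda>n w. w n) w (y, if w 0 = y then Suc n else n)"
proof -
  have c: "card {i. i < Suc k \<and> w i = y} = (if w 0 = y then 1 else 0) + card {i. i < k \<and> w (Suc i) = y}" for k
  proof -
    have "{i. i < Suc k \<and> w i = y} = (if w 0 = y then {0} else {}) \<union> Suc ` {i. i < k \<and> w (Suc i) = y}"
    proof (intro equalityI subsetI)
      fix i assume "i \<in> {i. i < Suc k \<and> w i = y}"
      then show "i \<in> (if w 0 = y then {0} else {}) \<union> Suc ` {i. i < k \<and> w (Suc i) = y}"
        by (cases i) auto
    qed (auto split: if_splits)
    then show ?thesis
      by (subst \<open>_ = _\<close>, subst card_Un_disjoint) (auto simp: card_image)
  qed
  have "successors (\<lambda>n w. w n) (\<lambda>n. w (Suc n)) (y, n) = Some z \<longleftrightarrow>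
    successors (\<lambda>n w. w n) w (y, if w 0 = y then Suc n else n) = Some z" for z
    unfolding successors_eq_Some_iff
  proof
    assume "\<exists>k. w (Suc k) = y \<and> card {i. i < k \<and> w (Suc i) = y} = n \<and> w (Suc (Suc k)) = z"
    then obtain k where "w (Suc k) = y" "card {i. i < k \<and> w (Suc i) = y} = n" "w (Suc (Suc k)) = z" by auto
    then show "\<exists>k. w k = y \<and> card {i. i < k \<and> w i = y} = (if w 0 = y then Suc n else n) \<and> w (Suc k) = z"
      using c[of k] by (intro exI[of _ "Suc k"]) auto
  next
    assume "\<exists>k. w k = y \<and> card {i. i < k \<and> w i = y} = (if w 0 = y then Suc n else n) \<and> w (Suc k) = z"
    then obtain k where k: "w k = y" "card {i. i < k \<and> w i = y} = (if w 0 = y then Suc n else n)" "w (Suc k) = z" by auto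
    \<comment> \<open>No visit precedes time 0, but \<open>w 0 = y\<close> would require the count
      \<open>Suc n\<close>.\<close>
    have "k \<noteq> 0" using k by (auto intro: ccontr)
    then obtain l where "k = Suc l" by (cases k) auto
    then show "\<exists>k. w (Suc k) = y \<and> card {i. i < k \<and> w (Suc i) = y} = n \<and> w (Suc (Suc k)) = z"
      using k c[of l] by (intro exI[of _ l]) (auto split: if_splits)
  qed
  then show ?thesis by (metis not_None_eq)
qed

section \<open>Row permutations and exchangeable events\<close>

definition row_perms :: "('s \<Rightarrow> nat \<Rightarrow> nat) set" where
  "row_perms = {\<pi>. \<forall>y. \<exists>F. finite F \<and> \<pi> y permutes F}"

lemma transpose_row_perms: "(\<lambda>y'. if y' = y then Transposition.transpose i j else id) \<in> row_perms"
proof -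
  have "\<exists>F. finite F \<and> (if y' = y then Transposition.transpose i j else id) permutes F" for y'
    by (intro exI[of _ "{i, j}"]) (auto intro: permutes_swap_id permutes_id)
  then show ?thesis by (simp add: row_perms_def)
qed

lemma partially_exchangeable_measure_eq:
  fixes Y :: "nat \<Rightarrow> 'a \<Rightarrow> 's::countable"
  assumes [measurable]: "\<And>n. Y n \<in> measurable M (count_space UNIV)"
    and "partially_exchangeable M Y" "\<pi> \<in> row_perms"
    and [measurable]: "Measurable.pred (\<Pi>\<^sub>M _\<in>UNIV. count_space UNIV) A"
  shows "measure M {\<omega> \<in> space M. A (\<lambda>(y, n). successors Y \<omega> (y, \<pi> y n))}
    = measure M {\<omega> \<in> space M. A (successors Y \<omega>)}"
proof -
  let ?S = "(\<Pi>\<^sub>M _\<in>UNIV. count_space UNIV) :: ('s \<times> nat \<Rightarrow> 's option) measure"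
  let ?V = "\<lambda>\<omega> (y, n). successors Y \<omega> (y, \<pi> y n)"
  have comp: "(\<lambda>v. v p) \<in> measurable ?S (count_space UNIV)" for p
    by (rule measurable_component_singleton) simp
  have [measurable]: "?V \<in> measurable M ?S"
  proof (rule measurable_PiM_single')
    show "(\<lambda>\<omega>. ?V \<omega> p) \<in> measurable M (count_space UNIV)" for p
      using measurable_compose[OF measurable_successors comp, of Y M "(fst p, \<pi> (fst p) (snd p))"] assms(1)
      by (simp add: case_prod_beta)
  qed auto
  have A: "{v \<in> space ?S. A v} \<in> sets ?S" using assms(4) by simp
  have *: "measure (distr M ?S f) {v \<in> space ?S. A v} = measure M {\<omega> \<in> space M. A (f \<omega>)}"
    if [measurable]: "f \<in> measurable M ?S" for f
    by (subst measure_distr[OF that A]) (auto intro!: arg_cong[where f="measure M"] simp: space_PiM)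
  have "distr M ?S ?V = distr M ?S (successors Y)"
    using assms(2,3) by (simp add: partially_exchangeable_def row_perms_def)
  then show ?thesis using *[of ?V] *[of "successors Y"] by simp
qed

section \<open>From mixtures to hidden Markov models\<close>

text \<open>Countable additivity over the values of \<open>X\<close>, with one factor
  \<open>c\<close> for all fibres. It is used to sum out a state, a finite history or a return
  time.\<close>

lemma (in finite_measure) measure_eq_on_fibres:
  fixes X :: "'a \<Rightarrow> 'x::countable"
  assumes [measurable]: "X \<in> measurable M (count_space UNIV)" "Measurable.pred M A" "Measurable.pred M B"
    and "0 \<le> c"
    and eq: "\<And>a. \<P>(\<omega> in M. X \<omega> = a \<and> A \<omega>) = c * \<P>(\<omega> in M. X \<omega> = a \<and> B \<omega>)"
  shows "\<P>(\<omega> in M. A \<omega>) = c * \<P>(\<omega> in M. B \<omega>)"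
proof -
  have split: "emeasure M {\<omega> \<in> space M. C \<omega>}
    = (\<integral>\<^sup>+a. emeasure M {\<omega> \<in> space M. X \<omega> = a \<and> C \<omega>} \<partial>count_space UNIV)"
    if [measurable]: "Measurable.pred M C" for C
  proof -
    have "{\<omega> \<in> space M. C \<omega>} = (\<Union>a. {\<omega> \<in> space M. X \<omega> = a \<and> C \<omega>})" by auto
    then show ?thesis
      by (simp only:) (subst emeasure_UN_countable, auto simp: disjoint_family_on_def)
  qed
  have "ennreal (\<P>(\<omega> in M. A \<omega>)) = (\<integral>\<^sup>+a. ennreal c * emeasure M {\<omega> \<in> space M. X \<omega> = a \<and> B \<omega>} \<partial>count_space UNIV)"
    using split[of A] by (simp add: emeasure_eq_measure eq ennreal_mult \<open>0 \<le> c\<close>)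
  also have "\<dots> = ennreal c * emeasure M {\<omega> \<in> space M. B \<omega>}"
    by (subst nn_integral_cmult) (simp_all flip: split)
  also have "\<dots> = ennreal (c * \<P>(\<omega> in M. B \<omega>))"
    by (simp add: emeasure_eq_measure ennreal_mult \<open>0 \<le> c\<close>)
  finally show ?thesis by (simp add: \<open>0 \<le> c\<close>)
qed

lemma (in prob_space) homogeneous_markov_chainI:
  fixes X :: "nat \<Rightarrow> 'a \<Rightarrow> 'x::countable" and p :: "'x \<Rightarrow> 'x \<Rightarrow> real"
  assumes [measurable]: "\<And>n. X n \<in> measurable M (count_space UNIV)"
    and p: "\<And>i j. 0 \<le> p i j"
    and step: "\<And>n x. \<P>(\<omega> in M. \<forall>i\<le>Suc n. X i \<omega> = x i)
      = p (x n) (x (Suc n)) * \<P>(\<omega> in M. \<forall>i\<le>n. X i \<omega> = x i)"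
  shows "homogeneous_markov_chain M X"
proof -
  \<comment> \<open>Homogeneity compares different times, so the product formula is needed for paths
    that start at any time \<open>k\<close>. The earlier states are summed out one by one;
    \<open>k = n\<close> gives the one-step law.\<close>
  have window: "\<P>(\<omega> in M. \<forall>i\<in>{k..Suc n}. X i \<omega> = x i)
      = p (x n) (x (Suc n)) * \<P>(\<omega> in M. \<forall>i\<in>{k..n}. X i \<omega> = x i)" if "k \<le> n" for k n x
    using that
  proof (induction k arbitrary: x)
    case 0
    have [simp]: "{0..m} = {..m}" for m :: nat by auto
    show ?case using step[of n x] by (simp add: Ball_def)
  next
    case (Suc k)
    show ?case
    proof (rule measure_eq_on_fibres[where X="X k"])
      fix a
      have *: "(X k \<omega> = a \<and> (\<forall>i\<in>{Suc k..m}. X i \<omega> = x i)) \<longleftrightarrow> (\<forall>i\<in>{k..m}. X i \<omega> = (x(k := a)) i)"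
        if "k \<le> m" for m \<omega>
        using that by (auto simp: Suc_le_eq le_less)
      show "\<P>(\<omega> in M. X k \<omega> = a \<and> (\<forall>i\<in>{Suc k..Suc n}. X i \<omega> = x i))
        = p (x n) (x (Suc n)) * \<P>(\<omega> in M. X k \<omega> = a \<and> (\<forall>i\<in>{Suc k..n}. X i \<omega> = x i))"
        using Suc.IH[of "x(k := a)"] Suc.prems by (simp add: *)
    qed (use p in auto)
  qed
  have single: "\<P>(\<omega> in M. X (Suc n) \<omega> = j \<bar> X n \<omega> = i) = p i j" if "\<P>(\<omega> in M. X n \<omega> = i) > 0" for n i j
  proof -
    have "{n..Suc n} = {n, Suc n}" by auto
    then have "\<P>(\<omega> in M. X n \<omega> = i \<and> X (Suc n) \<omega> = j) = p i j * \<P>(\<omega> in M. X n \<omega> = i)"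
      using window[of n n "(\<lambda>_. i)(Suc n := j)"] by simp
    then show ?thesis using that by (simp add: cond_prob_def conj_commute)
  qed
  show ?thesis
    unfolding homogeneous_markov_chain_def
  proof (intro conjI allI impI)
    fix n x j assume pos: "\<P>(\<omega> in M. \<forall>i\<le>n. X i \<omega> = x i) > 0"
    have "\<P>(\<omega> in M. \<forall>i\<le>n. X i \<omega> = x i) \<le> \<P>(\<omega> in M. X n \<omega> = x n)"
      by (rule finite_measure_mono) auto
    with pos have "\<P>(\<omega> in M. X n \<omega> = x n) > 0" by linarith
    moreover have "(X (Suc n) \<omega> = j \<and> (\<forall>i\<le>n. X i \<omega> = x i)) \<longleftrightarrow> (\<forall>i\<le>Suc n. X i \<omega> = (x(Suc n := j)) i)" for \<omega>
      by (auto simp: le_Suc_eq)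
    moreover have "(\<forall>i\<le>n. X i \<omega> = (x(Suc n := j)) i) \<longleftrightarrow> (\<forall>i\<le>n. X i \<omega> = x i)" for \<omega>
      by auto
    ultimately show "\<P>(\<omega> in M. X (Suc n) \<omega> = j \<bar> \<forall>i\<le>n. X i \<omega> = x i) = \<P>(\<omega> in M. X (Suc n) \<omega> = j \<bar> X n \<omega> = x n)"
      using pos step[of n "x(Suc n := j)"] by (simp add: single) (simp add: cond_prob_def)
  qed (simp_all add: single)
qed

lemma successors_eq_None_iff:
  "successors Y \<omega> (y, n) = None \<longleftrightarrow> finite {k. Y k \<omega> = y} \<and> card {k. Y k \<omega> = y} \<le> n"
  by (simp add: successors_def Let_def)

text \<open>A row with exactly \<open>m + 1\<close> entries different from \<open>None\<close> would, after exchanging entries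
  \<open>m\<close> and \<open>m + 1\<close>, have a gap, which no successors array has.\<close>

lemma partially_exchangeable_imp_visits_infinite:
  fixes Y :: "nat \<Rightarrow> 'a \<Rightarrow> 's::countable"
  assumes "prob_space M"
    and meas [measurable]: "\<And>n. Y n \<in> measurable M (count_space UNIV)"
    and pe: "partially_exchangeable M Y"
  shows "AE \<omega> in M. \<forall>k. \<exists>\<^sub>\<infinity>n. Y n \<omega> = Y k \<omega>"
proof -
  interpret prob_space M by fact
  let ?S = "(\<Pi>\<^sub>M _\<in>UNIV. count_space UNIV) :: ('s \<times> nat \<Rightarrow> 's option) measure"
  have comp [measurable]: "(\<lambda>v. v p) \<in> measurable ?S (count_space UNIV)" for p
    by (rule measurable_component_singleton) simp
  have V [measurable]: "(\<lambda>\<omega>. successors Y \<omega> p) \<in> measurable M (count_space UNIV)" for p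
    by (rule measurable_compose[OF measurable_successors comp]) (rule meas)
  have "AE \<omega> in M. \<not> (successors Y \<omega> (y, m) \<noteq> None \<and> successors Y \<omega> (y, Suc m) = None)" for y m
  proof -
    have "\<P>(\<omega> in M. successors Y \<omega> (y, m) \<noteq> None \<and> successors Y \<omega> (y, Suc m) = None)
      = \<P>(\<omega> in M. successors Y \<omega> (y, Suc m) \<noteq> None \<and> successors Y \<omega> (y, m) = None)"
      using partially_exchangeable_measure_eq[OF meas pe transpose_row_perms[of y m "Suc m"],
        of "\<lambda>v. v (y, m) \<noteq> None \<and> v (y, Suc m) = None"] by simp
    also have "\<dots> = \<P>(\<omega> in M. False)"
      by (rule arg_cong[where f="measure M"]) (auto simp del: not_None_eq simp: successors_eq_None_iff)
    finally have "\<P>(\<omega> in M. successors Y \<omega> (y, m) \<noteq> None \<and> successors Y \<omega> (y, Suc m) = None) = 0"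
      by simp
    then show ?thesis by (subst (asm) prob_Collect_eq_0) simp_all
  qed
  then have "AE \<omega> in M. \<forall>y m. \<not> (successors Y \<omega> (y, m) \<noteq> None \<and> successors Y \<omega> (y, Suc m) = None)"
    by (simp add: AE_all_countable)
  then show ?thesis
  proof eventually_elim
    case (elim \<omega>)
    have "infinite {n. Y n \<omega> = Y k \<omega>}" for k
    proof
      assume fin: "finite {n. Y n \<omega> = Y k \<omega>}"
      then have "card {n. Y n \<omega> = Y k \<omega>} > 0" by (subst card_gt_0_iff) auto
      then obtain m where "card {n. Y n \<omega> = Y k \<omega>} = Suc m" by (cases "card {n. Y n \<omega> = Y k \<omega>}") auto
      then show False using elim[rule_format, of "Y k \<omega>" m] fin
        by (auto simp: successors_eq_None_iff)
    qed
    then show ?case by (simp add: frequently_cofinite)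
  qed
qed

section \<open>Measurability in the space of matrices\<close>

lemma measurable_matrix_entry [measurable]:
  "(\<lambda>Q. Q i j) \<in> borel_measurable matrix_space"
proof -
  have "(\<lambda>Q. Q i) \<in> measurable matrix_space (\<Pi>\<^sub>M _\<in>UNIV. borel)"
    by (rule measurable_component_singleton) simp
  then show ?thesis by (rule measurable_compose) (simp add: measurable_component_singleton)
qed

text \<open>Single matrices are measurable because countably many entries determine them; this is
  where countability of the index type enters.\<close>

lemma countable_in_sets_matrix_space:
  fixes H :: "('i::countable \<Rightarrow> 'i \<Rightarrow> real) set"
  assumes "countable H"
  shows "H \<in> sets matrix_space"
proof -
  have "{Q} \<in> sets matrix_space" for Q :: "'i \<Rightarrow> 'i \<Rightarrow> real"
  proof -
    have "{R \<in> space matrix_space. \<forall>i j. R i j = Q i j} \<in> sets matrix_space" by measurable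
    moreover have "{R \<in> space matrix_space. \<forall>i j. R i j = Q i j} = {Q}"
      by (auto simp: space_PiM fun_eq_iff)
    ultimately show ?thesis by simp
  qed
  then show ?thesis by (rule sets.countable[OF _ assms])
qed

text \<open>The hidden chain draws an index once and keeps it, so its kernel is block diagonal with
  the matrices as blocks, and its read-out is deterministic. Recurrence is not read off the
  matrices: it comes from partial exchangeability through the infinitely many visits of Y.\<close>

lemma countable_mixture_imp_recurrent_hmm:
  fixes Y :: "nat \<Rightarrow> 'a \<Rightarrow> 's::countable"
  assumes "prob_space M"
    and meas [measurable]: "\<And>n. Y n \<in> measurable M (count_space UNIV)"
    and pe: "partially_exchangeable M Y"
    and start: "\<P>(\<omega> in M. Y 0 \<omega> = y\<^sub>0) = 1"
    and mix: "countable_markov_mixture M Y y\<^sub>0"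
  shows "recurrent_hmm M Y"
proof -
  interpret prob_space M by fact
  obtain P H where mixP: "markov_mixture_by M Y y\<^sub>0 P" and cH: "countable H"
    and tH: "\<And>Q. Q \<in> H \<Longrightarrow> transition_matrix Q" and PH: "AE \<omega> in M. P \<omega> \<in> H"
    using mix by (auto simp: countable_markov_mixture_def)
  have [measurable]: "P \<in> measurable M matrix_space"
    using mixP by (simp add: markov_mixture_by_def)
  let ?F = "vimage_algebra (space M) P matrix_space"
  have Pspace: "P \<in> space M \<rightarrow> space matrix_space" by (auto simp: space_PiM)
  have "subalgebra M ?F"
    unfolding subalgebra_def
    by (auto simp: sets_vimage_algebra2[OF Pspace] intro: measurable_sets)
  then interpret finite_measure_subalgebra M ?F by unfold_locales
  have Y0: "AE \<omega> in M. Y 0 \<omega> = y\<^sub>0"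
    using start by (subst (asm) prob_Collect_eq_1) simp_all
  have "H \<noteq> {}" using PH by auto
  then have H_range: "range (from_nat_into H) = H" using cH by (rule range_from_nat_into)
  define e where "e = from_nat_into H"
  \<comment> \<open>The enumeration \<open>e\<close> may repeat matrices, so the least index is
    chosen. \<open>D h\<close> collects the matrices with least index \<open>h\<close>, which makes
    \<open>I \<omega> = h\<close> almost surely an event generated by \<open>P\<close>.\<close>
  define I where "I = (\<lambda>\<omega>. LEAST h. P \<omega> = e h)"
  define D where "D h = {Q \<in> H. (LEAST h. Q = e h) = h}" for h
  define X where "X n \<omega> = (I \<omega>, Y n \<omega>)" for n \<omega>
  have e_nonneg: "0 \<le> e h i j" for h i j
    using tH[of "e h"] H_range by (auto simp: transition_matrix_def e_def)
  have eI: "Q = e h" if "Q \<in> D h" for Q h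
  proof -
    have "\<exists>k. Q = e k" using that H_range by (auto simp: D_def e_def)
    then have "Q = e (LEAST h. Q = e h)" by (rule LeastI_ex)
    with that show ?thesis by (simp add: D_def)
  qed
  have D [measurable]: "D h \<in> sets matrix_space" for h
    using cH by (intro countable_in_sets_matrix_space) (auto simp: D_def)
  have e_sets [measurable]: "{e h} \<in> sets matrix_space" for h
    by (intro countable_in_sets_matrix_space) auto
  have I [measurable]: "I \<in> measurable M (count_space UNIV)"
  proof -
    have "Measurable.pred M (\<lambda>\<omega>. P \<omega> \<in> {e h})" for h by measurable
    then show ?thesis unfolding I_def by (intro measurable_Least) simp
  qed
  have PD: "AE \<omega> in M. P \<omega> \<in> D h \<longleftrightarrow> I \<omega> = h" for h
    using PH by eventually_elim (simp add: D_def I_def)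
  have pair_measurable: "X n \<in> measurable M (count_space UNIV)" for n
  proof -
    have "X n \<in> measurable M (count_space UNIV \<Otimes>\<^sub>M count_space UNIV)"
      unfolding X_def by measurable
    then show ?thesis by (simp add: pair_measure_countable)
  qed
  note [measurable] = pair_measurable
  \<comment> \<open>The conditional probability is integrated over the event
    \<open>P \<omega> \<in> D h\<close>. There \<open>P\<close> is the constant matrix
    \<open>e h\<close>, so the product leaves the integral.\<close>
  have joint: "\<P>(\<omega> in M. I \<omega> = h \<and> (\<forall>n\<in>{1..N}. Y n \<omega> = y n))
    = \<P>(\<omega> in M. I \<omega> = h) * (\<Prod>n<N. e h (Some (y n)) (Some (y (Suc n))))" if "y 0 = y\<^sub>0" for h N y
  proof -
    let ?E = "{\<omega> \<in> space M. \<forall>n\<in>{1..N}. Some (Y n \<omega>) = Some (y n)}"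
    let ?A = "P -` D h \<inter> space M"
    let ?p = "\<Prod>n<N. e h (Some (y n)) (Some (y (Suc n)))"
    have A: "?A \<in> sets ?F" by (rule in_vimage_algebra) (rule D)
    have AM [measurable]: "?A \<in> sets M" by measurable
    have E [measurable]: "?E \<in> sets M" by measurable
    have ce: "AE \<omega> in M. real_cond_exp M ?F (indicator ?E) \<omega> = (\<Prod>n<N. P \<omega> (Some (y n)) (Some (y (Suc n))))"
      using mixP[unfolded markov_mixture_by_def, THEN conjunct2, THEN conjunct2, rule_format,
        of "\<lambda>n. Some (y n)" N] that by simp
    have "\<P>(\<omega> in M. I \<omega> = h \<and> (\<forall>n\<in>{1..N}. Y n \<omega> = y n)) = measure M (?A \<inter> ?E)"
      by (rule measure_eq_AE) (use PD[of h] in \<open>auto elim!: eventually_mono\<close>)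
    also have "\<dots> = (\<integral>\<omega>\<in>?A. indicator ?E \<omega> \<partial>M)"
      by (simp add: set_lebesgue_integral_def flip: indicator_inter_arith)
    also have "\<dots> = (\<integral>\<omega>\<in>?A. real_cond_exp M ?F (indicator ?E) \<omega> \<partial>M)"
      by (rule real_cond_exp_intA[OF _ A]) (simp add: integrable_indicator_iff emeasure_eq_measure)
    also have "\<dots> = (\<integral>\<omega>\<in>?A. ?p \<partial>M)"
      unfolding set_lebesgue_integral_def
    proof (rule integral_cong_AE)
      show "AE \<omega> in M. indicat_real ?A \<omega> *\<^sub>R real_cond_exp M ?F (indicator ?E) \<omega> = indicat_real ?A \<omega> *\<^sub>R ?p"
        using ce by eventually_elim (auto simp: indicator_def dest: eI)
    qed measurable
    also have "\<dots> = measure M ?A * ?p"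
      by (simp add: set_lebesgue_integral_def)
    also have "measure M ?A = \<P>(\<omega> in M. I \<omega> = h)"
      by (rule measure_eq_AE) (use PD[of h] in \<open>auto elim!: eventually_mono\<close>)
    finally show ?thesis .
  qed
  \<comment> \<open>Time 0 contributes no factor because \<open>Y 0\<close> is almost surely
    \<open>y\<^sub>0\<close>. A path that changes its index, or starts elsewhere, is null.\<close>
  have path: "\<P>(\<omega> in M. \<forall>i\<le>n. X i \<omega> = x i) =
    (if (\<forall>i\<le>n. fst (x i) = fst (x 0)) \<and> snd (x 0) = y\<^sub>0
     then \<P>(\<omega> in M. I \<omega> = fst (x 0)) * (\<Prod>i<n. e (fst (x 0)) (Some (snd (x i))) (Some (snd (x (Suc i)))))
     else 0)" for n x
  proof (cases "(\<forall>i\<le>n. fst (x i) = fst (x 0)) \<and> snd (x 0) = y\<^sub>0")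
    case True
    have "\<P>(\<omega> in M. \<forall>i\<le>n. X i \<omega> = x i) = \<P>(\<omega> in M. I \<omega> = fst (x 0) \<and> (\<forall>i\<in>{1..n}. Y i \<omega> = snd (x i)))"
    proof (rule measure_eq_AE)
      have "(\<forall>i\<le>n. X i \<omega> = x i) \<longleftrightarrow> I \<omega> = fst (x 0) \<and> (\<forall>i\<in>{1..n}. Y i \<omega> = snd (x i))" if "Y 0 \<omega> = y\<^sub>0" for \<omega>
      proof -
        have "(\<forall>i\<le>n. X i \<omega> = x i) \<longleftrightarrow> (\<forall>i\<le>n. I \<omega> = fst (x 0) \<and> Y i \<omega> = snd (x i))"
          unfolding X_def prod_eq_iff fst_conv snd_conv using True by metis
        also have "\<dots> \<longleftrightarrow> I \<omega> = fst (x 0) \<and> (\<forall>i\<in>{1..n}. Y i \<omega> = snd (x i))"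
        proof (intro iffI conjI ballI allI impI)
          fix i assume *: "I \<omega> = fst (x 0) \<and> (\<forall>i\<in>{1..n}. Y i \<omega> = snd (x i))" "i \<le> n"
          then show "I \<omega> = fst (x 0)" by blast
          show "Y i \<omega> = snd (x i)"
            using *(1)[THEN conjunct2, rule_format, of i] *(2) True[THEN conjunct2] that by (cases i) auto
        qed auto
        finally show ?thesis .
      qed
      then show "AE \<omega> in M. (\<omega> \<in> {\<omega> \<in> space M. \<forall>i\<le>n. X i \<omega> = x i}) =
        (\<omega> \<in> {\<omega> \<in> space M. I \<omega> = fst (x 0) \<and> (\<forall>i\<in>{1..n}. Y i \<omega> = snd (x i))})"
        using Y0 by (auto elim!: eventually_mono)
    qed measurable
    then show ?thesis
      unfolding if_P[OF True] using joint[of "\<lambda>i. snd (x i)", OF True[THEN conjunct2]] by simp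
  next
    case False
    have "AE \<omega> in M. \<not> (\<forall>i\<le>n. X i \<omega> = x i)"
      using Y0
    proof eventually_elim
      case (elim \<omega>)
      show ?case
      proof
        assume *: "\<forall>i\<le>n. X i \<omega> = x i"
        then have "fst (x i) = I \<omega>" if "i \<le> n" for i using that by (metis X_def fst_conv)
        moreover have "snd (x 0) = y\<^sub>0" using * elim by (metis X_def snd_conv zero_le)
        ultimately show False using False by auto
      qed
    qed
    then show ?thesis by (simp only: if_not_P[OF False]) (simp add: prob_Collect_eq_0)
  qed
  define p where "p a b = (if fst a = fst b then e (fst a) (Some (snd a)) (Some (snd b)) else 0)" for a b :: "nat \<times> 's"
  have "homogeneous_markov_chain M X"
  proof (rule homogeneous_markov_chainI[where p=p])
    fix n and x :: "nat \<Rightarrow> nat \<times> 's"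
    show "\<P>(\<omega> in M. \<forall>i\<le>Suc n. X i \<omega> = x i) = p (x n) (x (Suc n)) * \<P>(\<omega> in M. \<forall>i\<le>n. X i \<omega> = x i)"
    proof (cases "(\<forall>i\<le>n. fst (x i) = fst (x 0)) \<and> snd (x 0) = y\<^sub>0 \<and> fst (x (Suc n)) = fst (x 0)")
      case True
      then have x: "fst (x n) = fst (x 0)" "fst (x (Suc n)) = fst (x 0)" by blast+
      have const: "(\<forall>i\<le>Suc n. fst (x i) = fst (x 0)) \<and> snd (x 0) = y\<^sub>0"
        "(\<forall>i\<le>n. fst (x i) = fst (x 0)) \<and> snd (x 0) = y\<^sub>0"
        using True by (metis le_Suc_eq, blast)
      show ?thesis unfolding path p_def x if_P[OF const(1)] if_P[OF const(2)] by simp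
    next
      case False
      then have "\<not> ((\<forall>i\<le>Suc n. fst (x i) = fst (x 0)) \<and> snd (x 0) = y\<^sub>0)"
        by (meson le_Suc_eq order_refl)
      then have L: "\<P>(\<omega> in M. \<forall>i\<le>Suc n. X i \<omega> = x i) = 0" unfolding path by (rule if_not_P)
      show ?thesis
      proof (cases "(\<forall>i\<le>n. fst (x i) = fst (x 0)) \<and> snd (x 0) = y\<^sub>0")
        case True
        then have "p (x n) (x (Suc n)) = 0" using False unfolding p_def by (metis order_refl)
        then show ?thesis using L by simp
      next
        case False
        then have "\<P>(\<omega> in M. \<forall>i\<le>n. X i \<omega> = x i) = 0" unfolding path by (rule if_not_P)
        then show ?thesis using L by simp
      qed
    qed
  qed (auto simp: p_def e_nonneg)
  moreover have read_out: "\<P>(\<omega> in M. Y n \<omega> \<in> A \<bar> X n \<omega> = x) = (if snd x \<in> A then 1 else 0)"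
    if "\<P>(\<omega> in M. X n \<omega> = x) > 0" for n x A
  proof -
    have "{\<omega> \<in> space M. Y n \<omega> \<in> A \<and> X n \<omega> = x} = (if snd x \<in> A then {\<omega> \<in> space M. X n \<omega> = x} else {})"
      by (auto simp: X_def)
    then show ?thesis using that by (auto simp: cond_prob_def)
  qed
  moreover have "\<P>(\<omega> in M. (\<forall>n\<le>N. Y n \<omega> \<in> A n) \<bar> \<forall>n\<le>N. X n \<omega> = x n)
        = (\<Prod>n\<le>N. \<P>(\<omega> in M. Y n \<omega> \<in> A n \<bar> X n \<omega> = x n))"
    if pos: "\<P>(\<omega> in M. \<forall>n\<le>N. X n \<omega> = x n) > 0" for N x A
  proof -
    have "\<P>(\<omega> in M. X n \<omega> = x n) > 0" if "n \<le> N" for n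
    proof -
      have "\<P>(\<omega> in M. \<forall>n\<le>N. X n \<omega> = x n) \<le> \<P>(\<omega> in M. X n \<omega> = x n)"
        using that by (intro finite_measure_mono) auto
      with pos show ?thesis by linarith
    qed
    then have "(\<Prod>n\<le>N. \<P>(\<omega> in M. Y n \<omega> \<in> A n \<bar> X n \<omega> = x n)) = (\<Prod>n\<le>N. if snd (x n) \<in> A n then 1 else 0)"
      by (intro prod.cong) (auto simp: read_out)
    also have "\<dots> = (if \<forall>n\<le>N. snd (x n) \<in> A n then 1 else 0)"
      by (auto simp: prod_zero_iff)
    also have "{\<omega> \<in> space M. (\<forall>n\<le>N. Y n \<omega> \<in> A n) \<and> (\<forall>n\<le>N. X n \<omega> = x n)}
      = (if \<forall>n\<le>N. snd (x n) \<in> A n then {\<omega> \<in> space M. \<forall>n\<le>N. X n \<omega> = x n} else {})"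
      by (auto simp: X_def) (metis snd_conv)+
    then have "(if \<forall>n\<le>N. snd (x n) \<in> A n then 1 else 0)
      = \<P>(\<omega> in M. (\<forall>n\<le>N. Y n \<omega> \<in> A n) \<bar> \<forall>n\<le>N. X n \<omega> = x n)"
      using pos by (auto simp: cond_prob_def)
    finally show ?thesis by simp
  qed
  ultimately have "hmm_representation M Y M X Y"
    unfolding hmm_representation_def using assms(1) meas by (auto simp: read_out)
  moreover have "recurrent_chain M X"
    unfolding recurrent_chain_def
  proof (intro allI impI)
    fix x assume pos: "\<P>(\<omega> in M. X 1 \<omega> = x) > 0"
    have [measurable]: "Measurable.pred M (\<lambda>\<omega>. \<exists>\<^sub>\<infinity>n. X n \<omega> = x)"
      unfolding INFM_nat by measurable
    \<comment> \<open>The index does not move, so the pair returns to \<open>x\<close> whenever Y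
      returns to \<open>snd x\<close>. On this event Y visits \<open>snd x\<close> at time 1, hence
      almost surely infinitely often.\<close>
    have "\<P>(\<omega> in M. (\<exists>\<^sub>\<infinity>n. X n \<omega> = x) \<and> X 1 \<omega> = x) = \<P>(\<omega> in M. X 1 \<omega> = x)"
    proof (rule measure_eq_AE)
      show "AE \<omega> in M. (\<omega> \<in> {\<omega> \<in> space M. (\<exists>\<^sub>\<infinity>n. X n \<omega> = x) \<and> X 1 \<omega> = x}) = (\<omega> \<in> {\<omega> \<in> space M. X 1 \<omega> = x})"
        using partially_exchangeable_imp_visits_infinite[OF assms(1) meas pe]
        by eventually_elim (auto simp: X_def)
    qed measurable
    then show "\<P>(\<omega> in M. (\<exists>\<^sub>\<infinity>n. X n \<omega> = x) \<bar> X 1 \<omega> = x) = 1"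
      using pos by (simp add: cond_prob_def)
  qed
  ultimately show ?thesis by (rule recurrent_hmmI)
qed

section \<open>Laws of paths\<close>

abbreviation path_space :: "(nat \<Rightarrow> 'b) measure" where
  "path_space \<equiv> \<Pi>\<^sub>M _\<in>UNIV. count_space UNIV"

lemma measurable_path_component [measurable]:
  "(\<lambda>w. w i) \<in> measurable (\<Pi>\<^sub>M _\<in>UNIV. count_space UNIV) (count_space UNIV)"
  by (rule measurable_component_singleton) simp

text \<open>Long cylinders already generate. The lower bound \<open>k\<close> on the length lets a
  caller check only cylinders that fix the coordinate on which it conditions.\<close>

lemma measure_eqI_cylinders:
  fixes M N :: "(nat \<Rightarrow> 'b::countable) measure"
  assumes sets: "sets M = sets path_space" "sets N = sets path_space"
    and fin: "finite_measure M"
    and eq: "\<And>n w. k \<le> n \<Longrightarrow> emeasure M {v. \<forall>i<n. v i = w i} = emeasure N {v. \<forall>i<n. v i = w i}"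
  shows "M = N"
proof -
  define cyl where "cyl l = {v. \<forall>i<length l. v i = l ! i}" for l :: "'b list"
  define E where "E = insert {} (cyl ` {l. k \<le> length l})"
  \<comment> \<open>Two cylinders are nested or disjoint, which makes \<open>E\<close> stable under
    intersection.\<close>
  have inter: "cyl l \<inter> cyl l' \<in> {{}, cyl l'}" if "length l \<le> length l'" for l l'
  proof (cases "\<forall>i<length l. l ! i = l' ! i")
    case True
    then have "cyl l \<inter> cyl l' = cyl l'" using that by (auto simp: cyl_def)
    then show ?thesis by simp
  next
    case False
    then have "cyl l \<inter> cyl l' = {}" using that by (auto simp: cyl_def)
    then show ?thesis by simp
  qed
  have Int: "Int_stable E"
  proof (rule Int_stableI)
    fix a b assume "a \<in> E" "b \<in> E"
    then consider "a = {} \<or> b = {}" | l l' where "a = cyl l" "b = cyl l'" "k \<le> length l" "k \<le> length l'"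
      unfolding E_def by blast
    then show "a \<inter> b \<in> E"
    proof cases
      case 2
      show ?thesis
      proof (cases "length l \<le> length l'")
        case True
        then show ?thesis using inter[of l l'] 2 by (auto simp: E_def)
      next
        case False
        then have "b \<inter> a \<in> E" using inter[of l' l] 2 by (auto simp: E_def)
        then show ?thesis by (simp add: Int_commute)
      qed
    qed (auto simp: E_def)
  qed
  \<comment> \<open>The length \<open>max k (Suc i)\<close> is large enough both for membership in
    \<open>E\<close> and for the coordinate \<open>i\<close> to be fixed; the union is
    countable.\<close>
  have cover: "{v. v i \<in> A} = (\<Union>l\<in>{l. length l = max k (Suc i) \<and> l ! i \<in> A}. cyl l)" for i A
  proof (intro equalityI subsetI)
    fix v assume "v \<in> {v. v i \<in> A}"
    then show "v \<in> (\<Union>l\<in>{l. length l = max k (Suc i) \<and> l ! i \<in> A}. cyl l)"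
      by (intro UN_I[of "map v [0..<max k (Suc i)]"]) (auto simp: cyl_def nth_append)
  qed (auto simp: cyl_def)
  have S: "sets (path_space :: (nat \<Rightarrow> 'b) measure) = sigma_sets UNIV E"
  proof (intro equalityI)
    have "{v. v i \<in> A} \<in> sigma_sets UNIV E" for i A
      unfolding cover
    proof (rule sigma_sets_UNION)
      show "b \<in> sigma_sets UNIV E" if "b \<in> cyl ` {l. length l = max k (Suc i) \<and> l ! i \<in> A}" for b
        using that by (intro sigma_sets.Basic) (auto simp: E_def)
    qed auto
    then show "sets (path_space :: (nat \<Rightarrow> 'b) measure) \<subseteq> sigma_sets UNIV E"
      unfolding sets_PiM_single by (simp, intro sigma_sets_mono) auto
    have "cyl l \<in> sets path_space" for l :: "'b list"
    proof -
      have "{v \<in> space path_space. \<forall>i<length l. v i = l ! i} \<in> sets (path_space :: (nat \<Rightarrow> 'b) measure)"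
        by measurable
      then show ?thesis by (simp add: cyl_def space_PiM)
    qed
    then have "E \<subseteq> sets path_space" by (auto simp: E_def)
    then show "sigma_sets UNIV E \<subseteq> sets (path_space :: (nat \<Rightarrow> 'b) measure)"
      using sets.sigma_sets_subset[of E path_space] by (simp add: space_PiM)
  qed
  show ?thesis
  proof (rule measure_eqI_generator_eq_countable[OF Int])
    show "emeasure M a = emeasure N a" if "a \<in> E" for a
      using that eq by (auto simp: E_def cyl_def)
    show "cyl ` {l. length l = max k (Suc 0)} \<subseteq> E" by (auto simp: E_def)
    show "\<Union> (cyl ` {l. length l = max k (Suc 0)}) = UNIV"
      using cover[of 0 UNIV] by simp
    show "emeasure M a \<noteq> \<infinity>" for a
      using fin by (simp add: finite_measure.emeasure_finite)
  qed (auto simp: sets S)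
qed

lemma (in finite_measure) emeasure_distr_density_indicator:
  assumes [measurable]: "f \<in> measurable M S" "Measurable.pred M A" "C \<in> sets S"
  shows "emeasure (distr (density M (indicator {\<omega> \<in> space M. A \<omega>})) S f) C = ennreal (\<P>(\<omega> in M. A \<omega> \<and> f \<omega> \<in> C))"
  by (subst emeasure_distr, measurable, subst emeasure_density, measurable)
    (auto simp: emeasure_eq_measure simp flip: indicator_inter_arith intro!: arg_cong[where f="measure M"])

text \<open>Restriction to an event becomes a density and the factor \<open>c\<close> a scaling, so
  unnormalised conditional laws of paths, possibly on different spaces, are compared as finite
  measures.\<close>

lemma path_law_eqI:
  fixes U :: "nat \<Rightarrow> 'a \<Rightarrow> 'b::countable" and U' :: "nat \<Rightarrow> 'c \<Rightarrow> 'b"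
  assumes "finite_measure M" "finite_measure N"
    and [measurable]: "\<And>n. U n \<in> measurable M (count_space UNIV)" "\<And>n. U' n \<in> measurable N (count_space UNIV)"
      "Measurable.pred M A" "Measurable.pred N A'"
    and c: "0 \<le> c"
    and eq: "\<And>n w. k \<le> n \<Longrightarrow> \<P>(\<omega> in M. A \<omega> \<and> (\<forall>i<n. U i \<omega> = w i)) = c * \<P>(\<omega> in N. A' \<omega> \<and> (\<forall>i<n. U' i \<omega> = w i))"
    and B: "B \<in> sets path_space"
  shows "\<P>(\<omega> in M. A \<omega> \<and> (\<lambda>n. U n \<omega>) \<in> B) = c * \<P>(\<omega> in N. A' \<omega> \<and> (\<lambda>n. U' n \<omega>) \<in> B)"
proof -
  interpret M: finite_measure M by fact
  interpret N: finite_measure N by fact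
  have [measurable]: "(\<lambda>\<omega> n. U n \<omega>) \<in> measurable M path_space" "(\<lambda>\<omega> n. U' n \<omega>) \<in> measurable N path_space"
    by (auto intro!: measurable_PiM_single')
  define R where "R = distr (density M (indicator {\<omega> \<in> space M. A \<omega>})) path_space (\<lambda>\<omega> n. U n \<omega>)"
  define R' where "R' = scale_measure c (distr (density N (indicator {\<omega> \<in> space N. A' \<omega>})) path_space (\<lambda>\<omega> n. U' n \<omega>))"
  have R: "emeasure R C = ennreal (\<P>(\<omega> in M. A \<omega> \<and> (\<lambda>n. U n \<omega>) \<in> C))" if "C \<in> sets path_space" for C
    unfolding R_def by (rule M.emeasure_distr_density_indicator) (use that in measurable)
  have R': "emeasure R' C = ennreal (c * \<P>(\<omega> in N. A' \<omega> \<and> (\<lambda>n. U' n \<omega>) \<in> C))" if "C \<in> sets path_space" for C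
    unfolding R'_def emeasure_scale_measure
    by (subst N.emeasure_distr_density_indicator) (use that c in \<open>auto simp: ennreal_mult\<close>)
  have "R = R'"
  proof (rule measure_eqI_cylinders)
    show "sets R = sets path_space" "sets R' = sets path_space" by (simp_all add: R_def R'_def)
    show "finite_measure R"
      by (rule finite_measureI) (simp add: R_def R[unfolded R_def] sets.top[of path_space, simplified space_PiM, simplified])
    fix n and w :: "nat \<Rightarrow> 'b" assume "k \<le> n"
    have "{v \<in> space path_space. \<forall>i<n. v i = w i} \<in> sets (path_space :: (nat \<Rightarrow> 'b) measure)"
      by measurable
    then have "{v. \<forall>i<n. v i = w i} \<in> sets path_space" by (simp add: space_PiM)
    then show "emeasure R {v. \<forall>i<n. v i = w i} = emeasure R' {v. \<forall>i<n. v i = w i}"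
      by (simp add: R R' eq[OF \<open>k \<le> n\<close>])
  qed
  then show ?thesis using R[OF B] R'[OF B] c by simp
qed

section \<open>A zero-one law for recurrent hidden Markov models\<close>

lemma (in prob_space) cond_prob_eq_1_imp_AE:
  assumes [measurable]: "Measurable.pred M A" "Measurable.pred M B"
    and one: "\<P>(\<omega> in M. A \<omega> \<bar> B \<omega>) = 1"
  shows "AE \<omega> in M. B \<omega> \<longrightarrow> A \<omega>"
proof -
  have "\<P>(\<omega> in M. A \<omega> \<and> B \<omega>) = \<P>(\<omega> in M. B \<omega>)"
    using one by (auto simp: cond_prob_def)
  moreover have "{\<omega> \<in> space M. B \<omega> \<and> \<not> A \<omega>} = {\<omega> \<in> space M. B \<omega>} - {\<omega> \<in> space M. A \<omega> \<and> B \<omega>}" by auto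
  ultimately have "\<P>(\<omega> in M. B \<omega> \<and> \<not> A \<omega>) = 0"
    by (simp add: finite_measure_Diff Collect_mono_iff)
  then show ?thesis by (subst (asm) prob_Collect_eq_0) simp_all
qed

locale hmm = prob_space Q for Q :: "'b measure" +
  fixes X :: "nat \<Rightarrow> 'b \<Rightarrow> 'x::countable" and Z :: "nat \<Rightarrow> 'b \<Rightarrow> 's::countable"
  assumes chain: "homogeneous_markov_chain Q X"
    and measurable_Z [measurable]: "\<And>n. Z n \<in> measurable Q (count_space UNIV)"
    and read_out_indep: "\<And>N x A. \<P>(\<omega> in Q. \<forall>n\<le>N. X n \<omega> = x n) > 0 \<Longrightarrow>
        \<P>(\<omega> in Q. (\<forall>n\<le>N. Z n \<omega> \<in> A n) \<bar> \<forall>n\<le>N. X n \<omega> = x n)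
        = (\<Prod>n\<le>N. \<P>(\<omega> in Q. Z n \<omega> \<in> A n \<bar> X n \<omega> = x n))"
    and read_out_homogeneous: "\<And>m n x A. \<P>(\<omega> in Q. X m \<omega> = x) > 0 \<Longrightarrow> \<P>(\<omega> in Q. X n \<omega> = x) > 0 \<Longrightarrow>
        \<P>(\<omega> in Q. Z m \<omega> \<in> A \<bar> X m \<omega> = x) = \<P>(\<omega> in Q. Z n \<omega> \<in> A \<bar> X n \<omega> = x)"
begin

section \<open>Product formulas for the hidden pair\<close>

lemma measurable_X [measurable]: "X n \<in> measurable Q (count_space UNIV)"
  using chain by (simp add: homogeneous_markov_chain_def)

definition W :: "nat \<Rightarrow> 'b \<Rightarrow> 'x \<times> 's" where
  "W n \<omega> = (X n \<omega>, Z n \<omega>)"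

lemma measurable_W [measurable]: "W n \<in> measurable Q (count_space UNIV)"
proof -
  have "W n \<in> measurable Q (count_space UNIV \<Otimes>\<^sub>M count_space UNIV)"
    unfolding W_def by measurable
  then show ?thesis by (simp add: pair_measure_countable)
qed

text \<open>A time at which the state \<open>x\<close> has positive probability; if there is none, the kernels below
  are junk at \<open>x\<close>, but then they only ever occur multiplied by a null probability.\<close>

definition charged :: "'x \<Rightarrow> nat" where
  "charged x = (SOME m. \<P>(\<omega> in Q. X m \<omega> = x) > 0)"

definition trans :: "'x \<Rightarrow> 'x \<Rightarrow> real" where
  "trans x x' = \<P>(\<omega> in Q. X (Suc (charged x)) \<omega> = x' \<bar> X (charged x) \<omega> = x)"

definition emit :: "'x \<Rightarrow> 's set \<Rightarrow> real" where
  "emit x A = \<P>(\<omega> in Q. Z (charged x) \<omega> \<in> A \<bar> X (charged x) \<omega> = x)"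

lemma charged: "\<P>(\<omega> in Q. X m \<omega> = x) > 0 \<Longrightarrow> \<P>(\<omega> in Q. X (charged x) \<omega> = x) > 0"
  unfolding charged_def by (rule someI)

lemma path_pos_imp_state_pos:
  assumes "\<P>(\<omega> in Q. \<forall>i\<le>n. X i \<omega> = x i) > 0" "m \<le> n"
  shows "\<P>(\<omega> in Q. X m \<omega> = x m) > 0"
proof -
  have "\<P>(\<omega> in Q. \<forall>i\<le>n. X i \<omega> = x i) \<le> \<P>(\<omega> in Q. X m \<omega> = x m)"
    using assms(2) by (intro finite_measure_mono) auto
  with assms(1) show ?thesis by linarith
qed

text \<open>The Markov property without division: null paths are included, since both sides vanish
  there. The junk values of \<open>trans\<close> thus do no harm.\<close>

lemma prob_hidden_path_Suc:
  "\<P>(\<omega> in Q. \<forall>i\<le>Suc n. X i \<omega> = x i) = \<P>(\<omega> in Q. \<forall>i\<le>n. X i \<omega> = x i) * trans (x n) (x (Suc n))"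
proof (cases "\<P>(\<omega> in Q. \<forall>i\<le>n. X i \<omega> = x i) > 0")
  case True
  note n = path_pos_imp_state_pos[OF True order_refl]
  have "\<P>(\<omega> in Q. X (Suc n) \<omega> = x (Suc n) \<bar> \<forall>i\<le>n. X i \<omega> = x i) = trans (x n) (x (Suc n))"
  proof -
    have "\<P>(\<omega> in Q. X (Suc n) \<omega> = x (Suc n) \<bar> \<forall>i\<le>n. X i \<omega> = x i)
      = \<P>(\<omega> in Q. X (Suc n) \<omega> = x (Suc n) \<bar> X n \<omega> = x n)"
      by (rule chain[unfolded homogeneous_markov_chain_def, THEN conjunct2, THEN conjunct1, rule_format, OF True])
    also have "\<dots> = trans (x n) (x (Suc n))"
      unfolding trans_def
      by (rule chain[unfolded homogeneous_markov_chain_def, THEN conjunct2, THEN conjunct2, rule_format,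
        OF n charged[OF n]])
    finally show ?thesis .
  qed
  moreover have "(X (Suc n) \<omega> = x (Suc n) \<and> (\<forall>i\<le>n. X i \<omega> = x i)) \<longleftrightarrow> (\<forall>i\<le>Suc n. X i \<omega> = x i)" for \<omega>
    by (auto simp: le_Suc_eq)
  ultimately show ?thesis using True by (simp add: cond_prob_def field_simps)
next
  case False
  then have "\<P>(\<omega> in Q. \<forall>i\<le>n. X i \<omega> = x i) = 0" using measure_nonneg[of Q] by (simp add: not_less order_antisym)
  moreover have "\<P>(\<omega> in Q. \<forall>i\<le>Suc n. X i \<omega> = x i) \<le> \<P>(\<omega> in Q. \<forall>i\<le>n. X i \<omega> = x i)"
    by (intro finite_measure_mono) auto
  ultimately show ?thesis using measure_nonneg[of Q "{\<omega> \<in> space Q. \<forall>i\<le>Suc n. X i \<omega> = x i}"] by simp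
qed

lemma prob_path_read_out:
  "\<P>(\<omega> in Q. (\<forall>i\<le>n. Z i \<omega> \<in> A i) \<and> (\<forall>i\<le>n. X i \<omega> = x i))
    = \<P>(\<omega> in Q. \<forall>i\<le>n. X i \<omega> = x i) * (\<Prod>i\<le>n. emit (x i) (A i))"
proof (cases "\<P>(\<omega> in Q. \<forall>i\<le>n. X i \<omega> = x i) > 0")
  case True
  have "(\<Prod>i\<le>n. \<P>(\<omega> in Q. Z i \<omega> \<in> A i \<bar> X i \<omega> = x i)) = (\<Prod>i\<le>n. emit (x i) (A i))"
  proof (intro prod.cong refl)
    fix i assume "i \<in> {..n}"
    then have i: "\<P>(\<omega> in Q. X i \<omega> = x i) > 0" using path_pos_imp_state_pos[OF True, of i] by simp
    show "\<P>(\<omega> in Q. Z i \<omega> \<in> A i \<bar> X i \<omega> = x i) = emit (x i) (A i)"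
      unfolding emit_def by (rule read_out_homogeneous[OF i charged[OF i]])
  qed
  then show ?thesis using read_out_indep[OF True, of A] True by (simp add: cond_prob_def field_simps)
next
  case False
  then have "\<P>(\<omega> in Q. \<forall>i\<le>n. X i \<omega> = x i) = 0" using measure_nonneg[of Q] by (simp add: not_less order_antisym)
  moreover have "\<P>(\<omega> in Q. (\<forall>i\<le>n. Z i \<omega> \<in> A i) \<and> (\<forall>i\<le>n. X i \<omega> = x i)) \<le> \<P>(\<omega> in Q. \<forall>i\<le>n. X i \<omega> = x i)"
    by (intro finite_measure_mono) auto
  ultimately show ?thesis
    using measure_nonneg[of Q "{\<omega> \<in> space Q. (\<forall>i\<le>n. Z i \<omega> \<in> A i) \<and> (\<forall>i\<le>n. X i \<omega> = x i)}"] by simp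
qed

lemma prob_W_path:
  "\<P>(\<omega> in Q. \<forall>i\<le>n. W i \<omega> = w i)
    = \<P>(\<omega> in Q. \<forall>i\<le>n. X i \<omega> = fst (w i)) * (\<Prod>i\<le>n. emit (fst (w i)) {snd (w i)})"
proof -
  have "(\<forall>i\<le>n. W i \<omega> = w i) \<longleftrightarrow> (\<forall>i\<le>n. Z i \<omega> \<in> {snd (w i)}) \<and> (\<forall>i\<le>n. X i \<omega> = fst (w i))" for \<omega>
    by (auto simp: W_def prod_eq_iff)
  then show ?thesis using prob_path_read_out[where A="\<lambda>i. {snd (w i)}" and n=n and x="\<lambda>i. fst (w i)"] by simp
qed

text \<open>Splits time \<open>t\<close> between the hidden state and its letter. Leaving the letter
  free means emitting into \<open>UNIV\<close>, which has weight 1 at a charged state.\<close>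

lemma prob_W_path_state:
  "\<P>(\<omega> in Q. (\<forall>i<t. W i \<omega> = w i) \<and> X t \<omega> = fst (w t)) * emit (fst (w t)) {snd (w t)}
    = \<P>(\<omega> in Q. \<forall>i\<le>t. W i \<omega> = w i)"
proof (cases "\<P>(\<omega> in Q. \<forall>i\<le>t. X i \<omega> = fst (w i)) > 0")
  case True
  have t: "\<P>(\<omega> in Q. X t \<omega> = fst (w t)) > 0" by (rule path_pos_imp_state_pos[OF True order_refl])
  have one: "emit (fst (w t)) UNIV = 1" using charged[OF t] by (simp add: emit_def cond_prob_def)
  then have "(\<Prod>i\<le>t. emit (fst (w i)) (if i = t then UNIV else {snd (w i)})) = (\<Prod>i<t. emit (fst (w i)) {snd (w i)})"
    by (simp add: lessThan_Suc_atMost[symmetric])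
  moreover have "((\<forall>i<t. W i \<omega> = w i) \<and> X t \<omega> = fst (w t)) \<longleftrightarrow>
    (\<forall>i\<le>t. Z i \<omega> \<in> (if i = t then UNIV else {snd (w i)})) \<and> (\<forall>i\<le>t. X i \<omega> = fst (w i))" for \<omega>
    by (auto simp: W_def prod_eq_iff le_less)
  ultimately show ?thesis
    using prob_path_read_out[where A="\<lambda>i. if i = t then UNIV else {snd (w i)}" and n=t and x="\<lambda>i. fst (w i)"]
    by (simp add: prob_W_path lessThan_Suc_atMost[symmetric] one)
next
  case False
  then have "\<P>(\<omega> in Q. \<forall>i\<le>t. X i \<omega> = fst (w i)) = 0" using measure_nonneg[of Q] by (simp add: not_less order_antisym)
  moreover have "\<P>(\<omega> in Q. (\<forall>i<t. W i \<omega> = w i) \<and> X t \<omega> = fst (w t)) \<le> \<P>(\<omega> in Q. \<forall>i\<le>t. X i \<omega> = fst (w i))"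
    by (intro finite_measure_mono) (auto simp: W_def prod_eq_iff le_less)
  ultimately show ?thesis
    using measure_nonneg[of Q "{\<omega> \<in> space Q. (\<forall>i<t. W i \<omega> = w i) \<and> X t \<omega> = fst (w t)}"]
    by (simp add: prob_W_path)
qed

text \<open>The weight of the block \<open>u 0, ..., u L\<close> given only the hidden state at its
  first time: the block starts with an emission, not with a transition.\<close>

definition path_weight :: "nat \<Rightarrow> (nat \<Rightarrow> 'x \<times> 's) \<Rightarrow> real" where
  "path_weight L u = emit (fst (u 0)) {snd (u 0)} *
     (\<Prod>j<L. trans (fst (u j)) (fst (u (Suc j))) * emit (fst (u (Suc j))) {snd (u (Suc j))})"

text \<open>The Markov property of the pair in unnormalised form: the factor for the future depends
  neither on the time \<open>t\<close> nor on the past \<open>w\<close>.\<close>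

lemma prob_W_path_future:
  "\<P>(\<omega> in Q. (\<forall>i<t. W i \<omega> = w i) \<and> (\<forall>j\<le>L. W (t + j) \<omega> = u j))
    = path_weight L u * \<P>(\<omega> in Q. (\<forall>i<t. W i \<omega> = w i) \<and> X t \<omega> = fst (u 0))"
proof -
  define v where "v i = (if i < t then w i else u (i - t))" for i
  have v: "((\<forall>i<t. W i \<omega> = w i) \<and> (\<forall>j\<le>L. W (t + j) \<omega> = u j)) \<longleftrightarrow> (\<forall>i\<le>t + L. W i \<omega> = v i)" for \<omega> L
  proof safe
    fix i assume "\<forall>i<t. W i \<omega> = w i" "\<forall>j\<le>L. W (t + j) \<omega> = u j" "i \<le> t + L"
    then show "W i \<omega> = v i" by (cases "i < t") (auto simp: v_def dest: spec[of _ "i - t"])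
  qed (auto simp: v_def)
  have "\<P>(\<omega> in Q. \<forall>i\<le>t + L. W i \<omega> = v i)
    = path_weight L u * \<P>(\<omega> in Q. (\<forall>i<t. W i \<omega> = w i) \<and> X t \<omega> = fst (u 0))"
  proof (induction L)
    case 0
    have "((\<forall>i<t. W i \<omega> = v i) \<and> X t \<omega> = fst (v t)) \<longleftrightarrow> ((\<forall>i<t. W i \<omega> = w i) \<and> X t \<omega> = fst (u 0))" for \<omega>
      by (auto simp: v_def)
    then show ?case using prob_W_path_state[of t v] by (simp add: path_weight_def v_def mult.commute)
  next
    case (Suc L)
    have "v (t + L) = u L" "v (Suc (t + L)) = u (Suc L)" by (auto simp: v_def)
    then show ?case
      using Suc prob_hidden_path_Suc[of "t + L" "\<lambda>i. fst (v i)"]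
      by (simp add: prob_W_path path_weight_def mult_ac)
  qed
  then show ?thesis by (simp add: v)
qed

lemma emit_nonneg: "0 \<le> emit x A" by (simp add: emit_def cond_prob_def)

lemma trans_nonneg: "0 \<le> trans x x'" by (simp add: trans_def cond_prob_def)

lemma path_weight_nonneg: "0 \<le> path_weight L u"
  unfolding path_weight_def by (intro mult_nonneg_nonneg prod_nonneg emit_nonneg trans_nonneg ballI)

lemma history_eq_iff: "map (\<lambda>i. W i \<omega>) [0..<t] = l \<longleftrightarrow> length l = t \<and> (\<forall>i<t. W i \<omega> = l ! i)"
  unfolding list_eq_iff_nth_eq by force

lemma measurable_history: "(\<lambda>\<omega>. map (\<lambda>i. W i \<omega>) [0..<t]) \<in> measurable Q (count_space UNIV)"
proof -
  have "{\<omega> \<in> space Q. length l = t \<and> (\<forall>i<t. W i \<omega> = l ! i)} \<in> sets Q" for l by measurable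
  moreover have "(\<lambda>\<omega>. map (\<lambda>i. W i \<omega>) [0..<t]) -` {l} \<inter> space Q
    = {\<omega> \<in> space Q. length l = t \<and> (\<forall>i<t. W i \<omega> = l ! i)}" for l
    unfolding history_eq_iff[symmetric] by auto
  ultimately show ?thesis by (simp add: measurable_count_space_eq2_countable)
qed

text \<open>Histories are lists over a countable type, so an arbitrary condition \<open>C\<close> on
  the past is a countable union of single pasts.\<close>

lemma prob_past_future:
  "\<P>(\<omega> in Q. C (map (\<lambda>i. W i \<omega>) [0..<t]) \<and> (\<forall>j\<le>L. W (t + j) \<omega> = u j))
    = path_weight L u * \<P>(\<omega> in Q. C (map (\<lambda>i. W i \<omega>) [0..<t]) \<and> X t \<omega> = fst (u 0))"
proof (rule measure_eq_on_fibres[OF measurable_history])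
  have [measurable]: "Measurable.pred Q (\<lambda>\<omega>. C (map (\<lambda>i. W i \<omega>) [0..<t]))"
    using measurable_compose[OF measurable_history, of C "count_space UNIV" t] by simp
  show "Measurable.pred Q (\<lambda>\<omega>. C (map (\<lambda>i. W i \<omega>) [0..<t]) \<and> (\<forall>j\<le>L. W (t + j) \<omega> = u j))"
    "Measurable.pred Q (\<lambda>\<omega>. C (map (\<lambda>i. W i \<omega>) [0..<t]) \<and> X t \<omega> = fst (u 0))"
    by measurable
  fix l
  have map_eq: "(map (\<lambda>i. W i \<omega>) [0..<t] = l \<and> C (map (\<lambda>i. W i \<omega>) [0..<t]) \<and> R) \<longleftrightarrow>
    (map (\<lambda>i. W i \<omega>) [0..<t] = l \<and> C l \<and> R)" for R \<omega> by blast
  have fibre: "(map (\<lambda>i. W i \<omega>) [0..<t] = l \<and> C (map (\<lambda>i. W i \<omega>) [0..<t]) \<and> R) \<longleftrightarrow>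
    (length l = t \<and> C l) \<and> (\<forall>i<t. W i \<omega> = l ! i) \<and> R" for R \<omega>
    using map_eq[of \<omega> R] history_eq_iff[of \<omega> t l] by blast
  show "\<P>(\<omega> in Q. map (\<lambda>i. W i \<omega>) [0..<t] = l \<and> C (map (\<lambda>i. W i \<omega>) [0..<t]) \<and> (\<forall>j\<le>L. W (t + j) \<omega> = u j))
    = path_weight L u * \<P>(\<omega> in Q. map (\<lambda>i. W i \<omega>) [0..<t] = l \<and> C (map (\<lambda>i. W i \<omega>) [0..<t]) \<and> X t \<omega> = fst (u 0))"
    unfolding fibre using prob_W_path_future[of t "\<lambda>i. l ! i" L u] by (cases "length l = t"; cases "C l") simp_all
qed (rule path_weight_nonneg)

lemma measurable_history_pred [measurable]: "Measurable.pred Q (\<lambda>\<omega>. C (map (\<lambda>i. W i \<omega>) [0..<t]))"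
  using measurable_compose[OF measurable_history, of C "count_space UNIV" t] by simp

lemma measurable_W_path [measurable]: "(\<lambda>\<omega> n. W n \<omega>) \<in> measurable Q path_space"
  by (auto intro!: measurable_PiM_single')

text \<open>Whatever happened before \<open>t\<close>, from state \<open>x\<close> the pair
  continues as it does from time 1 given \<open>X 1 = x\<close>, since both futures have the same
  path weights. A cylinder of length at least 1 fixes the hidden state at its first time, so it
  implies or excludes the condition on that state.\<close>

lemma regeneration:
  assumes pos: "\<P>(\<omega> in Q. X 1 \<omega> = x) > 0" and B: "B \<in> sets path_space"
  shows "\<P>(\<omega> in Q. (C (map (\<lambda>i. W i \<omega>) [0..<t]) \<and> X t \<omega> = x) \<and> (\<lambda>j. W (t + j) \<omega>) \<in> B)
    = \<P>(\<omega> in Q. C (map (\<lambda>i. W i \<omega>) [0..<t]) \<and> X t \<omega> = x) / \<P>(\<omega> in Q. X 1 \<omega> = x)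
      * \<P>(\<omega> in Q. X 1 \<omega> = x \<and> (\<lambda>j. W (1 + j) \<omega>) \<in> B)"
proof (rule path_law_eqI[where k=1, OF _ _ _ _ _ _ _ _ B])
  fix n :: nat and w assume "1 \<le> n"
  then obtain L where n: "n = Suc L" by (cases n) auto
  show "\<P>(\<omega> in Q. (C (map (\<lambda>i. W i \<omega>) [0..<t]) \<and> X t \<omega> = x) \<and> (\<forall>i<n. W (t + i) \<omega> = w i))
    = \<P>(\<omega> in Q. C (map (\<lambda>i. W i \<omega>) [0..<t]) \<and> X t \<omega> = x) / \<P>(\<omega> in Q. X 1 \<omega> = x)
      * \<P>(\<omega> in Q. X 1 \<omega> = x \<and> (\<forall>i<n. W (1 + i) \<omega> = w i))"
  proof (cases "fst (w 0) = x")
    case True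
    have *: "((R \<and> X s \<omega> = x) \<and> (\<forall>i<n. W (s + i) \<omega> = w i)) \<longleftrightarrow> (R \<and> (\<forall>i\<le>L. W (s + i) \<omega> = w i))" for R s \<omega>
    proof -
      have "X s \<omega> = x" if "\<forall>i\<le>L. W (s + i) \<omega> = w i"
        using that[rule_format, of 0] True by (metis W_def add.right_neutral fst_conv le0)
      then show ?thesis by (auto simp: n less_Suc_eq_le)
    qed
    have "\<P>(\<omega> in Q. X 1 \<omega> = x \<and> (\<forall>i<n. W (1 + i) \<omega> = w i)) = path_weight L w * \<P>(\<omega> in Q. X 1 \<omega> = x)"
      using prob_past_future[of "\<lambda>_. True" 1 L w] True *[of True 1, simplified] by simp
    then show ?thesis
      unfolding * using prob_past_future[of C t L w] True pos by simp
  next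
    case False
    have "\<not> (X s \<omega> = x \<and> (\<forall>i<n. W (s + i) \<omega> = w i))" for s \<omega>
    proof
      assume "X s \<omega> = x \<and> (\<forall>i<n. W (s + i) \<omega> = w i)"
      then have "X s \<omega> = x" "W (s + 0) \<omega> = w 0" using n by blast+
      then show False using False by (metis W_def add.right_neutral fst_conv)
    qed
    then have "{\<omega> \<in> space Q. (D \<omega> \<and> X s \<omega> = x) \<and> (\<forall>i<n. W (s + i) \<omega> = w i)} = {}"
      "{\<omega> \<in> space Q. X s \<omega> = x \<and> (\<forall>i<n. W (s + i) \<omega> = w i)} = {}" for s D
      by blast+
    then show ?thesis by (simp only: measure_empty mult_zero_right)
  qed
qed (use finite_measure_axioms in \<open>auto\<close>)

text \<open>Given \<open>X 1 = x\<close>, the event \<open>B\<close> has probability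
  \<open>h\<close> and is independent of every cylinder, hence of every event of the path and in
  particular of itself. So \<open>h = h * h\<close>.\<close>

lemma shift_invariant_zero_one:
  assumes rec: "recurrent_chain Q X" and pos: "\<P>(\<omega> in Q. X 1 \<omega> = x) > 0"
    and B [measurable]: "B \<in> sets path_space"
    and inv: "\<And>w. (\<lambda>n. w (Suc n)) \<in> B \<longleftrightarrow> w \<in> B"
  shows "(AE \<omega> in Q. X 1 \<omega> = x \<longrightarrow> (\<lambda>n. W n \<omega>) \<in> B) \<or> (AE \<omega> in Q. X 1 \<omega> = x \<longrightarrow> (\<lambda>n. W n \<omega>) \<notin> B)"
proof -
  define q where "q = \<P>(\<omega> in Q. X 1 \<omega> = x)"
  define h where "h = \<P>(\<omega> in Q. X 1 \<omega> = x \<and> (\<lambda>n. W n \<omega>) \<in> B) / q"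
  have q: "q > 0" and h: "0 \<le> h" using pos by (simp_all add: q_def h_def)
  have shift: "(\<lambda>j. w (t + j)) \<in> B \<longleftrightarrow> w \<in> B" for w t
  proof (induction t)
    case (Suc t)
    then show ?case using inv[of "\<lambda>j. w (t + j)"] by simp
  qed simp
  have shiftW: "(\<lambda>j. W (t + j) \<omega>) \<in> B \<longleftrightarrow> (\<lambda>n. W n \<omega>) \<in> B" for t \<omega>
    using shift[of "\<lambda>n. W n \<omega>" t] by simp
  have io: "AE \<omega> in Q. X 1 \<omega> = x \<longrightarrow> (\<exists>\<^sub>\<infinity>n. X n \<omega> = x)"
  proof -
    have [measurable]: "Measurable.pred Q (\<lambda>\<omega>. \<exists>\<^sub>\<infinity>n. X n \<omega> = x)"
      unfolding INFM_nat by measurable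
    have "\<P>(\<omega> in Q. (\<exists>\<^sub>\<infinity>n. X n \<omega> = x) \<bar> X 1 \<omega> = x) = 1"
      using rec pos by (simp add: recurrent_chain_def)
    then show ?thesis by (intro cond_prob_eq_1_imp_AE) simp_all
  qed
  \<comment> \<open>With length at least 2 the cylinder fixes coordinate 1, so the condition
    \<open>X 1 = x\<close> is part of the history.\<close>
  have cyl: "\<P>(\<omega> in Q. (X 1 \<omega> = x \<and> (\<lambda>n. W n \<omega>) \<in> B) \<and> (\<forall>i<n. W i \<omega> = w i))
    = h * \<P>(\<omega> in Q. X 1 \<omega> = x \<and> (\<forall>i<n. W i \<omega> = w i))" if n: "2 \<le> n" for n w
  proof -
    define F where "F \<omega> \<longleftrightarrow> X 1 \<omega> = x \<and> (\<forall>i<n. W i \<omega> = w i)" for \<omega>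
    \<comment> \<open>The first visit to \<open>x\<close> at or after time \<open>n\<close>. Without
      such a visit the value of \<open>LEAST\<close> is meaningless, so \<open>T\<close> is always
      used together with \<open>R\<close>.\<close>
    define T where "T \<omega> = (LEAST t. n \<le> t \<and> X t \<omega> = x)" for \<omega>
    define R where "R \<omega> \<longleftrightarrow> (\<exists>t\<ge>n. X t \<omega> = x)" for \<omega>
    have [measurable]: "Measurable.pred Q F" "Measurable.pred Q R" "T \<in> measurable Q (count_space UNIV)"
      unfolding F_def R_def T_def by measurable
    have T: "T \<omega> = t \<and> R \<omega> \<longleftrightarrow> n \<le> t \<and> (\<forall>i\<in>{n..<t}. X i \<omega> \<noteq> x) \<and> X t \<omega> = x" for \<omega> t
    proof
      assume "T \<omega> = t \<and> R \<omega>"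
      then have "R \<omega>" and t: "t = (LEAST t. n \<le> t \<and> X t \<omega> = x)" by (auto simp: T_def)
      have "n \<le> t \<and> X t \<omega> = x"
        unfolding t by (rule LeastI_ex) (use \<open>R \<omega>\<close> in \<open>simp add: R_def\<close>)
      moreover have "\<not> (n \<le> i \<and> X i \<omega> = x)" if "i < t" for i
        using that unfolding t by (rule not_less_Least)
      ultimately show "n \<le> t \<and> (\<forall>i\<in>{n..<t}. X i \<omega> \<noteq> x) \<and> X t \<omega> = x" by simp
    next
      assume t: "n \<le> t \<and> (\<forall>i\<in>{n..<t}. X i \<omega> \<noteq> x) \<and> X t \<omega> = x"
      then have "T \<omega> = t" unfolding T_def by (intro Least_equality) (auto simp: not_less[symmetric])
      then show "T \<omega> = t \<and> R \<omega>" using t by (auto simp: R_def)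
    qed
    \<comment> \<open>The only use of recurrence in this argument: on \<open>F\<close> a return
      after \<open>n\<close> is almost sure, so adding \<open>R\<close> changes no
      probability.\<close>
    have FR: "\<P>(\<omega> in Q. F \<omega> \<and> D \<omega>) = \<P>(\<omega> in Q. R \<omega> \<and> F \<omega> \<and> D \<omega>)" if [measurable]: "Measurable.pred Q D" for D
    proof (rule measure_eq_AE)
      show "AE \<omega> in Q. (\<omega> \<in> {\<omega> \<in> space Q. F \<omega> \<and> D \<omega>}) = (\<omega> \<in> {\<omega> \<in> space Q. R \<omega> \<and> F \<omega> \<and> D \<omega>})"
        using io by eventually_elim (auto simp: F_def R_def INFM_nat_le)
    qed measurable
    have "\<P>(\<omega> in Q. R \<omega> \<and> F \<omega> \<and> (\<lambda>n. W n \<omega>) \<in> B) = h * \<P>(\<omega> in Q. R \<omega> \<and> F \<omega> \<and> True)"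
    proof (rule measure_eq_on_fibres[where X=T])
      fix t
      show "\<P>(\<omega> in Q. T \<omega> = t \<and> R \<omega> \<and> F \<omega> \<and> (\<lambda>n. W n \<omega>) \<in> B) = h * \<P>(\<omega> in Q. T \<omega> = t \<and> R \<omega> \<and> F \<omega> \<and> True)"
      proof (cases "n \<le> t")
        case True
        \<comment> \<open>The cylinder together with the absence of a visit during
          \<open>{n..<t}\<close>, as a condition on the history before \<open>t\<close>. All indices
          are below \<open>t\<close> because \<open>2 \<le> n\<close> and \<open>n \<le> t\<close>,
          so regeneration at the fixed time \<open>t\<close> applies.\<close>
        define C where "C l \<longleftrightarrow> fst (l ! 1) = x \<and> (\<forall>i<n. l ! i = w i) \<and> (\<forall>i\<in>{n..<t}. fst (l ! i) \<noteq> x)"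
          for l :: "('x \<times> 's) list"
        have C: "(T \<omega> = t \<and> R \<omega> \<and> F \<omega> \<and> D) \<longleftrightarrow> ((C (map (\<lambda>i. W i \<omega>) [0..<t]) \<and> X t \<omega> = x) \<and> D)" for \<omega> D
        proof -
          have "C (map (\<lambda>i. W i \<omega>) [0..<t]) \<longleftrightarrow> F \<omega> \<and> (\<forall>i\<in>{n..<t}. X i \<omega> \<noteq> x)"
            using n True by (auto simp: C_def F_def W_def)
          then show ?thesis using T[of \<omega> t] True by blast
        qed
        show ?thesis
          unfolding C using regeneration[OF pos B, of C t]
          by (simp only: shiftW simp_thms) (simp add: h_def q_def)
      next
        case False
        then have "\<not> (T \<omega> = t \<and> R \<omega>)" for \<omega> using T[of \<omega> t] by blast
        then have "{\<omega> \<in> space Q. T \<omega> = t \<and> R \<omega> \<and> D \<omega>} = {}" for D by blast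
        then show ?thesis by (simp only: measure_empty mult_zero_right)
      qed
    qed (auto simp: h)
    then show ?thesis
      using FR[of "\<lambda>\<omega>. (\<lambda>n. W n \<omega>) \<in> B"] FR[of "\<lambda>_. True"] by (simp add: F_def conj_ac)
  qed
  \<comment> \<open>Equality on cylinders extends to all path events; the event inserted is
    \<open>B\<close> itself.\<close>
  have "\<P>(\<omega> in Q. (X 1 \<omega> = x \<and> (\<lambda>n. W n \<omega>) \<in> B) \<and> (\<lambda>n. W n \<omega>) \<in> B)
    = h * \<P>(\<omega> in Q. X 1 \<omega> = x \<and> (\<lambda>n. W n \<omega>) \<in> B)"
    by (rule path_law_eqI[where k=2, OF finite_measure_axioms finite_measure_axioms _ _ _ _ h cyl B]) measurable
  then have "h = 0 \<or> h = 1"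
    using q by (simp add: h_def field_simps)
  then show ?thesis
  proof
    assume "h = 0"
    then have "\<P>(\<omega> in Q. X 1 \<omega> = x \<and> (\<lambda>n. W n \<omega>) \<in> B) = 0" using q by (simp add: h_def)
    then have "AE \<omega> in Q. \<not> (X 1 \<omega> = x \<and> (\<lambda>n. W n \<omega>) \<in> B)" by (subst (asm) prob_Collect_eq_0) simp_all
    then show ?thesis by simp
  next
    assume "h = 1"
    then have "\<P>(\<omega> in Q. (\<lambda>n. W n \<omega>) \<in> B \<bar> X 1 \<omega> = x) = 1" using q
      by (simp add: h_def cond_prob_def q_def conj_commute)
    then have "AE \<omega> in Q. X 1 \<omega> = x \<longrightarrow> (\<lambda>n. W n \<omega>) \<in> B" by (intro cond_prob_eq_1_imp_AE) simp_all
    then show ?thesis ..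
  qed
qed

end

section \<open>Limiting frequencies in row-exchangeable arrays\<close>

abbreviation array_space :: "('s \<times> nat \<Rightarrow> 'v) measure" where
  "array_space \<equiv> \<Pi>\<^sub>M _\<in>UNIV. count_space UNIV"

definition swap_row :: "'s \<Rightarrow> nat \<Rightarrow> nat \<Rightarrow> ('s \<times> nat \<Rightarrow> 'v) \<Rightarrow> 's \<times> nat \<Rightarrow> 'v" where
  "swap_row y i j v = (\<lambda>(y', n). v (y', if y' = y then Transposition.transpose i j n else n))"

definition row_freq :: "nat \<Rightarrow> ('s \<times> nat \<Rightarrow> 'v) \<Rightarrow> 's \<Rightarrow> 'v \<Rightarrow> real" where
  "row_freq L v y z = (\<Sum>j<L. if v (y, j) = z then 1 else 0) / L"

text \<open>The subsequence \<open>4 ^ k\<close> makes the \<open>L\<^sup>1\<close> distances of consecutive frequencies summable, which gives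
  almost sure convergence without the ergodic theorem; truncation to the unit interval only affects
  arrays without a limit.\<close>

definition limit_freq :: "('s \<times> nat \<Rightarrow> 'v) \<Rightarrow> 's \<Rightarrow> 'v \<Rightarrow> real" where
  "limit_freq v y z = max 0 (min 1 (lim (\<lambda>k. row_freq (4 ^ k) v y z)))"

lemma limit_freq_bounds: "0 \<le> limit_freq v y z" "limit_freq v y z \<le> 1"
  by (simp_all add: limit_freq_def)

lemma row_freq_nonneg: "0 \<le> row_freq L v y z"
  by (simp add: row_freq_def sum_nonneg)

lemma sum_row_freq_le_1:
  assumes "finite A"
  shows "(\<Sum>z\<in>A. row_freq L v y z) \<le> 1"
proof -
  have "(\<Sum>z\<in>A. \<Sum>j<L. if v (y, j) = z then 1 else 0) = (\<Sum>j<L. \<Sum>z\<in>A. if v (y, j) = z then 1 else (0::real))"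
    by (rule sum.swap)
  also have "\<dots> \<le> (\<Sum>j<L. 1)"
    using assms by (intro sum_mono) (simp add: sum.delta')
  finally show ?thesis
    by (cases "L = 0") (simp_all add: row_freq_def flip: sum_divide_distrib)
qed

lemma row_freq_le_1: "row_freq L v y z \<le> 1"
  using sum_row_freq_le_1[of "{z}" L v y] by simp

text \<open>No convergence is assumed: both sequences have the same set of limits, and
  \<open>lim\<close> depends on that set alone.\<close>

lemma lim_eq_if_diff_tendsto_0:
  fixes a b :: "nat \<Rightarrow> real"
  assumes "(\<lambda>k. a k - b k) \<longlonglongrightarrow> 0"
  shows "lim a = lim b"
proof -
  have "a \<longlonglongrightarrow> l \<longleftrightarrow> b \<longlonglongrightarrow> l" for l
  proof
    assume "a \<longlonglongrightarrow> l"
    from tendsto_diff[OF this assms] show "b \<longlonglongrightarrow> l" by simp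
  next
    assume "b \<longlonglongrightarrow> l"
    from tendsto_add[OF assms this] show "a \<longlonglongrightarrow> l" by simp
  qed
  then show ?thesis by (simp add: lim_def)
qed

text \<open>Once the averaged segment contains both columns, the transposition only reorders the
  terms of the sum.\<close>

lemma limit_freq_swap_row: "limit_freq (swap_row y i j v) = limit_freq v"
proof (intro ext)
  fix y' z
  have "row_freq L (swap_row y i j v) y' z = row_freq L v y' z" if "max i j < L" for L
  proof (cases "y' = y")
    case True
    have "Transposition.transpose i j permutes {..<L}" using that by (intro permutes_swap_id) auto
    then have "(\<Sum>n<L. if v (y, n) = z then 1 else 0)
      = (\<Sum>n<L. if v (y, Transposition.transpose i j n) = z then 1 else (0::real))"
      by (subst sum.permute) (simp_all add: comp_def)
    then show ?thesis using True by (simp add: row_freq_def swap_row_def)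
  qed (simp add: row_freq_def swap_row_def)
  moreover have "eventually (\<lambda>k. max i j < (4::nat) ^ k) sequentially"
    using eventually_gt_at_top[of "max i j"]
    by eventually_elim (erule order.strict_trans, rule power_gt_expt, simp)
  ultimately have "eventually (\<lambda>k. row_freq (4 ^ k) (swap_row y i j v) y' z - row_freq (4 ^ k) v y' z = 0) sequentially"
    by (auto elim!: eventually_mono)
  then have "(\<lambda>k. row_freq (4 ^ k) (swap_row y i j v) y' z - row_freq (4 ^ k) v y' z) \<longlonglongrightarrow> 0"
    by (rule tendsto_eventually)
  then show "limit_freq (swap_row y i j v) y' z = limit_freq v y' z"
    unfolding limit_freq_def by (simp add: lim_eq_if_diff_tendsto_0)
qed

text \<open>Removing the leading entry changes a sum of \<open>L\<close> indicators by a difference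
  of two boundary terms, hence the average by at most \<open>1 / L\<close>.\<close>

lemma limit_freq_successors_shift:
  "limit_freq (successors (\<lambda>n w. w n) (\<lambda>n. w (Suc n))) = limit_freq (successors (\<lambda>n w. w n) w)"
proof (intro ext)
  fix y z
  let ?v = "successors (\<lambda>n w. w n) w" and ?v' = "successors (\<lambda>n w. w n) (\<lambda>n. w (Suc n))"
  define f where "f n = (if ?v (y, n) = z then 1 else (0::real))" for n
  have "\<bar>row_freq L ?v' y z - row_freq L ?v y z\<bar> \<le> 1 / L" for L
  proof (cases "w 0 = y")
    case True
    have "(\<Sum>n<L. f (Suc n)) - (\<Sum>n<L. f n) = f L - f 0"
      by (induction L) auto
    then have "row_freq L ?v' y z - row_freq L ?v y z = (f L - f 0) / L"
      using True by (simp add: row_freq_def successors_shift f_def flip: diff_divide_distrib)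
    moreover have "\<bar>f L - f 0\<bar> \<le> 1" by (simp add: f_def)
    ultimately show ?thesis by (simp add: abs_divide divide_right_mono)
  next
    case False
    then have "row_freq L ?v' y z = row_freq L ?v y z" by (simp add: row_freq_def successors_shift)
    then show ?thesis by simp
  qed
  then have "\<bar>row_freq (4 ^ k) ?v' y z - row_freq (4 ^ k) ?v y z\<bar> \<le> (1 / 4) ^ k" for k
    by (metis of_nat_numeral of_nat_power power_one_over)
  then have "(\<lambda>k. row_freq (4 ^ k) ?v' y z - row_freq (4 ^ k) ?v y z) \<longlonglongrightarrow> 0"
    by (intro tendsto_rabs_zero_cancel[OF tendsto_sandwich[OF _ _ tendsto_const LIMSEQ_realpow_zero[of "1 / 4"]]]) auto
  then show "limit_freq ?v' y z = limit_freq ?v y z"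
    unfolding limit_freq_def by (simp add: lim_eq_if_diff_tendsto_0)
qed

text \<open>Only transpositions within one row are asked for: all later arguments move one entry at
  a time.\<close>

locale row_exchangeable = prob_space N
  for N :: "('s::countable \<times> nat \<Rightarrow> 'v::countable) measure" +
  assumes sets_N [measurable_cong]: "sets N = sets array_space"
    and swap_invariant: "\<And>y i j. distr N array_space (swap_row y i j) = N"
begin

lemma space_N [simp]: "space N = UNIV"
  using sets_eq_imp_space_eq[OF sets_N] by (simp add: space_PiM)

lemma measurable_entry [measurable]: "(\<lambda>v. v p) \<in> measurable N (count_space UNIV)"
proof -
  have "(\<lambda>v. v p) \<in> measurable array_space (count_space UNIV)"
    by (rule measurable_component_singleton) simp
  then show ?thesis by measurable
qed

lemma measurable_swap_row [measurable]: "swap_row y i j \<in> measurable N array_space"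
proof (rule measurable_PiM_single')
  show "(\<lambda>v. swap_row y i j v p) \<in> measurable N (count_space UNIV)" for p
    by (cases p) (simp add: swap_row_def)
qed auto

lemma measurable_row_freq [measurable]: "(\<lambda>v. row_freq L v y z) \<in> borel_measurable N"
  unfolding row_freq_def by measurable

lemma measurable_limit_freq [measurable]: "(\<lambda>v. limit_freq v y z) \<in> borel_measurable N"
  unfolding limit_freq_def by measurable

lemma integral_swap_row:
  fixes f :: "('s \<times> nat \<Rightarrow> 'v) \<Rightarrow> real"
  assumes "f \<in> borel_measurable N"
  shows "(\<integral>v. f (swap_row y i j v) \<partial>N) = (\<integral>v. f v \<partial>N)"
proof -
  have "f \<in> borel_measurable array_space" using assms by measurable
  from integral_distr[OF measurable_swap_row this, of y i j] show ?thesis by (simp add: swap_invariant)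
qed

lemma integrable_bounded:
  fixes f :: "('s \<times> nat \<Rightarrow> 'v) \<Rightarrow> real"
  assumes "f \<in> borel_measurable N" "\<And>v. \<bar>f v\<bar> \<le> B"
  shows "integrable N f"
  by (rule integrable_const_bound[of _ B]) (use assms in auto)

end

text \<open>The expected total variation of the sequence is finite, so the total variation is almost
  surely finite and the increments telescope to a limit.\<close>

lemma AE_convergent_of_summable_L1_increments:
  fixes s :: "nat \<Rightarrow> 'a \<Rightarrow> real"
  assumes [measurable]: "\<And>k. integrable M (s k)"
    and "summable b" and bound: "\<And>k. (\<integral>x. \<bar>s (Suc k) x - s k x\<bar> \<partial>M) \<le> b k"
  shows "AE x in M. convergent (\<lambda>k. s k x)"
proof -
  have s [measurable]: "s k \<in> borel_measurable M" for k by (rule borel_measurable_integrable) (rule assms)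
  have int: "integrable M (\<lambda>x. \<bar>s (Suc k) x - s k x\<bar>)" for k
    using assms(1) by (intro integrable_abs Bochner_Integration.integrable_diff)
  have b: "0 \<le> b k" for k
    using bound[of k] Bochner_Integration.integral_nonneg[of M "\<lambda>x. \<bar>s (Suc k) x - s k x\<bar>"] by linarith
  have "(\<integral>\<^sup>+x. (\<Sum>k. ennreal \<bar>s (Suc k) x - s k x\<bar>) \<partial>M) = (\<Sum>k. \<integral>\<^sup>+x. ennreal \<bar>s (Suc k) x - s k x\<bar> \<partial>M)"
    by (rule nn_integral_suminf) measurable
  also have "\<dots> = (\<Sum>k. ennreal (\<integral>x. \<bar>s (Suc k) x - s k x\<bar> \<partial>M))"
    using int by (simp add: nn_integral_eq_integral)
  also have "\<dots> \<le> (\<Sum>k. ennreal (b k))"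
    using bound by (intro suminf_le ennreal_leI) auto
  also have "\<dots> = ennreal (\<Sum>k. b k)"
    using b \<open>summable b\<close> by (intro suminf_ennreal2) auto
  finally have "(\<integral>\<^sup>+x. (\<Sum>k. ennreal \<bar>s (Suc k) x - s k x\<bar>) \<partial>M) \<noteq> \<infinity>"
    by (metis ennreal_less_top infinity_ennreal_def leD)
  then have "AE x in M. (\<Sum>k. ennreal \<bar>s (Suc k) x - s k x\<bar>) \<noteq> \<infinity>"
    by (intro nn_integral_PInf_AE) auto
  then show ?thesis
  proof eventually_elim
    case (elim x)
    then have "summable (\<lambda>k. \<bar>s (Suc k) x - s k x\<bar>)" by (intro summable_suminf_not_top) auto
    then have "summable (\<lambda>k. s (Suc k) x - s k x)" by (rule summable_rabs_cancel)
    then have "(\<lambda>n. \<Sum>k<n. s (Suc k) x - s k x) \<longlonglongrightarrow> (\<Sum>k. s (Suc k) x - s k x)" by (rule summable_LIMSEQ)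
    then have "(\<lambda>n. s n x - s 0 x) \<longlonglongrightarrow> (\<Sum>k. s (Suc k) x - s k x)"
      by (simp only: sum_lessThan_telescope[of "\<lambda>k. s k x"])
    from tendsto_add[OF this tendsto_const[of "s 0 x"]] show ?case by (auto simp: convergent_def)
  qed
qed

section \<open>Second moments and almost sure convergence of the frequencies\<close>

context row_exchangeable begin

lemma prob_UNIV [simp]: "prob UNIV = 1"
  using prob_space by simp

definition hit :: "'s \<Rightarrow> nat \<Rightarrow> 'v \<Rightarrow> ('s \<times> nat \<Rightarrow> 'v) \<Rightarrow> real" where
  "hit y j z v = (if v (y, j) = z then 1 else 0)"

lemma measurable_hit [measurable]: "hit y j z \<in> borel_measurable N"
  unfolding hit_def by measurable

lemma hit_bounds: "0 \<le> hit y j z v" "hit y j z v \<le> 1" "\<bar>hit y j z v\<bar> \<le> 1"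
  by (simp_all add: hit_def)

lemma row_freq_hit: "row_freq L v y z = (\<Sum>j<L. hit y j z v) / L"
  by (simp add: row_freq_def hit_def)

lemma hit_swap_row: "hit y j z (swap_row y' i k v) = hit y (if y = y' then Transposition.transpose i k j else j) z v"
  by (simp add: hit_def swap_row_def)

lemma integral_hit_cong: "(\<integral>v. hit y i z v \<partial>N) = (\<integral>v. hit y j z v \<partial>N)"
  using integral_swap_row[of "hit y i z" y i j] by (simp add: hit_swap_row)

lemma integral_hit_pair_cong:
  assumes "i \<noteq> j" "i' \<noteq> j'"
  shows "(\<integral>v. hit y i z v * hit y j z v \<partial>N) = (\<integral>v. hit y i' z v * hit y j' z v \<partial>N)"
proof -
  have move: "(\<integral>v. hit y i z v * hit y j z v \<partial>N) = (\<integral>v. hit y k z v * hit y j z v \<partial>N)"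
    if "i \<noteq> j" "k \<noteq> j" for i j k
    using integral_swap_row[of "\<lambda>v. hit y i z v * hit y j z v" y i k] that
    by (simp add: hit_swap_row transpose_apply_other)
  \<comment> \<open>Exceeds all four indices. Passing through the fresh columns \<open>k\<close> and
    \<open>Suc k\<close> keeps the two columns distinct at each single swap.\<close>
  define k where "k = Suc (i + j + i' + j')"
  have fresh: "(\<integral>v. hit y i z v * hit y j z v \<partial>N) = (\<integral>v. hit y (Suc k) z v * hit y k z v \<partial>N)"
    if "i \<noteq> j" "i < k" "j < k" for i j
    using move[of i j k] move[of j k "Suc k"] that by (simp add: mult.commute)
  show ?thesis using fresh[of i j] fresh[of i' j'] assms by (simp add: k_def)
qed

text \<open>All products of distinct entries have mean \<beta> and all squares have mean \<alpha>.
  In the expanded square the \<beta> terms cancel and only the diagonals, of relative size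
  \<open>1 / L\<close> and \<open>1 / L'\<close>, remain; the diagonal of the mixed term has a
  favourable sign and is dropped.\<close>

lemma row_freq_L2_distance:
  assumes "0 < L" "0 < L'"
  shows "(\<integral>v. (row_freq L v y z - row_freq L' v y z)\<^sup>2 \<partial>N) \<le> 1 / L + 1 / L'"
proof -
  define \<alpha> where "\<alpha> = (\<integral>v. hit y 0 z v \<partial>N)"
  define \<beta> where "\<beta> = (\<integral>v. hit y 0 z v * hit y 1 z v \<partial>N)"
  define m where "m L L' = (\<integral>v. row_freq L v y z * row_freq L' v y z \<partial>N)" for L L'
  have int [simp]: "integrable N (hit y i z)" "integrable N (\<lambda>v. hit y i z v * hit y j z v)" for i j
    by (rule integrable_bounded[of _ 1]; simp add: hit_def)+
  have pair: "(\<integral>v. hit y i z v * hit y j z v \<partial>N) = \<beta> + (if i = j then \<alpha> - \<beta> else 0)" for i j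
  proof (cases "i = j")
    case True
    have "(\<lambda>v. hit y j z v * hit y j z v) = hit y j z" by (simp add: fun_eq_iff hit_def)
    then show ?thesis using True integral_hit_cong[of y j z 0] by (simp only: \<alpha>_def) simp
  next
    case False
    then show ?thesis using integral_hit_pair_cong[of i j 0 1] by (simp add: \<beta>_def)
  qed
  have "0 \<le> \<beta>" unfolding \<beta>_def by (intro Bochner_Integration.integral_nonneg) (simp add: hit_def)
  moreover have "\<beta> \<le> \<alpha>" unfolding \<alpha>_def \<beta>_def by (rule integral_mono[OF int(2,1)]) (simp add: hit_def)
  moreover have "\<alpha> \<le> (\<integral>v. 1 \<partial>N)" unfolding \<alpha>_def by (rule integral_mono[OF int(1)]) (simp_all add: hit_def)
  ultimately have \<gamma>: "0 \<le> \<alpha> - \<beta>" "\<alpha> - \<beta> \<le> 1" by (simp_all add: prob_space)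
  have m: "m L L' = (\<Sum>i<L. \<Sum>j<L'. \<beta> + (if i = j then \<alpha> - \<beta> else 0)) / (L * L')" for L L'
  proof -
    have "m L L' = (\<integral>v. (\<Sum>i<L. \<Sum>j<L'. hit y i z v * hit y j z v) / (L * L') \<partial>N)"
      unfolding m_def row_freq_hit by (simp add: sum_product)
    then show ?thesis by (simp add: pair)
  qed
  have m_ge: "\<beta> \<le> m L L'" if "0 < L" "0 < L'" for L L'
  proof -
    have "(\<Sum>i<L. \<Sum>j<L'. \<beta>) \<le> (\<Sum>i<L. \<Sum>j<L'. \<beta> + (if i = j then \<alpha> - \<beta> else 0))"
      using \<gamma> by (intro sum_mono) simp
    then show ?thesis using that by (simp add: m field_simps)
  qed
  have m_eq: "m L L = \<beta> + (\<alpha> - \<beta>) / L" if "0 < L" for L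
    using that by (simp add: m sum.distrib field_simps)
  have int_freq [simp]: "integrable N (\<lambda>v. row_freq L v y z * row_freq L' v y z)" for L L'
    by (rule integrable_bounded[of _ 1]) (auto intro!: mult_le_one simp: row_freq_nonneg row_freq_le_1 abs_mult)
  have "(row_freq L v y z - row_freq L' v y z)\<^sup>2 = row_freq L v y z * row_freq L v y z
    - 2 * (row_freq L v y z * row_freq L' v y z) + row_freq L' v y z * row_freq L' v y z" for v
    by (simp add: power2_eq_square algebra_simps)
  then have "(\<integral>v. (row_freq L v y z - row_freq L' v y z)\<^sup>2 \<partial>N) = m L L - 2 * m L L' + m L' L'"
    by (simp add: m_def)
  also have "\<dots> \<le> (\<alpha> - \<beta>) * (1 / L + 1 / L')"
    using m_ge[OF assms] by (simp add: m_eq assms field_simps)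
  also have "\<dots> \<le> 1 * (1 / L + 1 / L')"
    using \<gamma> by (intro mult_right_mono) auto
  finally show ?thesis by simp
qed

lemma AE_row_freq_tendsto:
  "AE v in N. \<forall>y z. (\<lambda>k. row_freq (4 ^ k) v y z) \<longlonglongrightarrow> limit_freq v y z"
proof -
  have "AE v in N. (\<lambda>k. row_freq (4 ^ k) v y z) \<longlonglongrightarrow> limit_freq v y z" for y z
  proof -
    have int: "integrable N (\<lambda>v. row_freq L v y z)" for L
      by (rule integrable_bounded[of _ 1]) (auto simp: row_freq_nonneg row_freq_le_1)
    have "AE v in N. convergent (\<lambda>k. row_freq (4 ^ k) v y z)"
    proof (rule AE_convergent_of_summable_L1_increments[OF int])
      fix k
      let ?d = "\<lambda>v. row_freq (4 ^ Suc k) v y z - row_freq (4 ^ k) v y z"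
      \<comment> \<open>The squared distance is at most \<open>2 * e\<^sup>2\<close>. The inequality
        \<open>2 * \<bar>d\<bar> * e \<le> e\<^sup>2 + d\<^sup>2\<close> then bounds the mean of
        \<open>\<bar>d\<bar>\<close> by a multiple of \<open>e\<close>, in place of
        Cauchy-Schwarz.\<close>
      define e where "e = (1 / 2 :: real) ^ k"
      have e: "e > 0" by (simp add: e_def)
      have d1: "\<bar>?d v\<bar> \<le> 1" for v
        using row_freq_nonneg[of "4 ^ Suc k" v y z] row_freq_nonneg[of "4 ^ k" v y z]
          row_freq_le_1[of "4 ^ Suc k" v y z] row_freq_le_1[of "4 ^ k" v y z] by linarith
      then have int2: "integrable N (\<lambda>v. (?d v)\<^sup>2)"
        by (intro integrable_bounded[of _ 1]) (auto simp: abs_square_le_1)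
      have "(\<integral>v. \<bar>?d v\<bar> \<partial>N) \<le> (\<integral>v. (e + (?d v)\<^sup>2 / e) / 2 \<partial>N)"
      proof (rule integral_mono)
        fix v
        have "0 \<le> (\<bar>?d v\<bar> - e)\<^sup>2" by simp
        then have "2 * \<bar>?d v\<bar> * e \<le> e\<^sup>2 + (?d v)\<^sup>2" by (simp add: power2_diff)
        then show "\<bar>?d v\<bar> \<le> (e + (?d v)\<^sup>2 / e) / 2"
          using e by (simp add: field_simps power2_eq_square)
      qed (use int int2 in auto)
      also have "\<dots> = (e + (\<integral>v. (?d v)\<^sup>2 \<partial>N) / e) / 2"
        using int2 by (simp add: prob_space)
      also have "(\<integral>v. (?d v)\<^sup>2 \<partial>N) \<le> 2 * e\<^sup>2"
      proof -
        have "1 / real (4 ^ k) = e\<^sup>2" by (simp add: e_def power_mult[symmetric] power_one_over power_mult mult.commute[of k])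
        moreover have "1 / real (4 ^ Suc k) \<le> 1 / real (4 ^ k)" by (simp add: field_simps)
        moreover have "(0::nat) < 4 ^ Suc k" "(0::nat) < 4 ^ k" by simp_all
        note row_freq_L2_distance[OF this, of y z]
        ultimately show ?thesis by linarith
      qed
      then have "(e + (\<integral>v. (?d v)\<^sup>2 \<partial>N) / e) / 2 \<le> (e + (2 * e\<^sup>2) / e) / 2"
        using e by (intro divide_right_mono add_left_mono) auto
      also have "\<dots> \<le> 2 * e" using e by (simp add: power2_eq_square)
      finally show "(\<integral>v. \<bar>?d v\<bar> \<partial>N) \<le> 2 * (1 / 2) ^ k" by (simp add: e_def)
    qed (intro summable_mult summable_geometric, simp)
    then show ?thesis
    proof eventually_elim
      case (elim v)
      then have lim: "(\<lambda>k. row_freq (4 ^ k) v y z) \<longlonglongrightarrow> lim (\<lambda>k. row_freq (4 ^ k) v y z)"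
        by (simp add: convergent_LIMSEQ_iff)
      moreover have "0 \<le> lim (\<lambda>k. row_freq (4 ^ k) v y z)"
        by (rule LIMSEQ_le_const[OF lim]) (auto simp: row_freq_nonneg)
      moreover have "lim (\<lambda>k. row_freq (4 ^ k) v y z) \<le> 1"
        by (rule LIMSEQ_le_const2[OF lim]) (auto simp: row_freq_le_1)
      ultimately show ?case by (simp add: limit_freq_def)
    qed
  qed
  then show ?thesis by (simp add: AE_all_countable)
qed

end

section \<open>De Finetti's theorem for arrays: entries replaced by limiting frequencies\<close>

lemma mean_of_eventually_const_tendsto:
  fixes e :: "nat \<Rightarrow> real"
  assumes "\<And>j. J \<le> j \<Longrightarrow> e j = c"
  shows "(\<lambda>L. (\<Sum>j<L. e j) / real L) \<longlonglongrightarrow> c"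
proof -
  define C where "C = (\<Sum>j<J. e j - c)"
  have "(\<Sum>j<L. e j) / real L = C / real L + c" if "Suc J \<le> L" for L
  proof -
    have "(\<Sum>j<L. e j - c) = C"
      unfolding C_def using that assms by (intro sum.mono_neutral_right) auto
    then show ?thesis using that by (simp add: sum_subtractf field_simps)
  qed
  then have ev: "eventually (\<lambda>L. C / real L + c = (\<Sum>j<L. e j) / real L) sequentially"
    by (intro eventually_mono[OF eventually_ge_at_top[of "Suc J"]]) simp
  have "(\<lambda>L. C / real L + c) \<longlonglongrightarrow> 0 + c"
    by (intro tendsto_add tendsto_const lim_const_over_n)
  then show ?thesis using tendsto_cong[OF ev] by simp
qed

context row_exchangeable begin

text \<open>Each entry of a row can be traded for the limiting frequency of the row, because it is
  exchangeable with all entries beyond the finitely many indices in play.\<close>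

lemma integral_hits_eq_limit_freqs:
  fixes m :: nat
  assumes "G \<in> borel_measurable N" "\<And>v. \<bar>G v\<bar> \<le> 1" "\<And>y i j v. G (swap_row y i j v) = G v"
    and "inj_on (\<lambda>n. (s n, c n)) {..<m}"
  shows "(\<integral>v. G v * (\<Prod>n<m. hit (s n) (c n) (z n) v) \<partial>N)
    = (\<integral>v. G v * (\<Prod>n<m. limit_freq v (s n) (z n)) \<partial>N)"
  using assms
proof (induction m arbitrary: G)
  case (Suc m)
  note [measurable] = Suc.prems(1)
  define H where "H v = G v * (\<Prod>n<m. hit (s n) (c n) (z n) v)" for v
  define e where "e j = (\<integral>v. H v * hit (s m) j (z m) v \<partial>N)" for j
  define J where "J = Suc (\<Sum>n\<le>m. c n)"
  have [measurable]: "H \<in> borel_measurable N" unfolding H_def by measurable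
  have "\<bar>\<Prod>n<m. hit (s n) (c n) (z n) v\<bar> \<le> 1" for v
    unfolding abs_prod by (rule prod_le_1) (simp add: hit_def)
  then have H1: "\<bar>H v\<bar> \<le> 1" for v
    unfolding H_def abs_mult using Suc.prems(2)[of v] by (intro mult_le_one) auto
  have cJ: "c n < J" if "n \<le> m" for n
    using member_le_sum[of n "{..m}" c] that by (simp add: J_def less_Suc_eq_le)
  have inj: "inj_on (\<lambda>n. (s n, c n)) {..<m}"
    using Suc.prems(4) by (rule inj_on_subset) auto
  \<comment> \<open>Swapping columns \<open>c m\<close> and \<open>j\<close> in row
    \<open>s m\<close> leaves \<open>H\<close> alone: \<open>j\<close> lies beyond all columns in
    use, and by injectivity no other factor uses column \<open>c m\<close> of this row.\<close>
  have e_const: "e j = e (c m)" if "J \<le> j" for j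
  proof -
    have "H (swap_row (s m) (c m) j v) * hit (s m) (c m) (z m) (swap_row (s m) (c m) j v)
      = H v * hit (s m) j (z m) v" for v
    proof -
      have "hit (s n) (c n) (z n) (swap_row (s m) (c m) j v) = hit (s n) (c n) (z n) v" if "n < m" for n
      proof -
        have "c n \<noteq> j" using cJ[of n] \<open>J \<le> j\<close> that by simp
        moreover have "s n = s m \<Longrightarrow> c n \<noteq> c m"
          using Suc.prems(4) that by (auto dest!: inj_onD[where x=n and y=m])
        ultimately show ?thesis by (simp add: hit_swap_row transpose_apply_other)
      qed
      then show ?thesis by (simp add: H_def Suc.prems(3) hit_swap_row)
    qed
    then show ?thesis
      using integral_swap_row[of "\<lambda>v. H v * hit (s m) (c m) (z m) v" "s m" "c m" j]
      by (simp add: e_def)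
  qed
  have Hhit: "integrable N (\<lambda>v. H v * hit (s m) j (z m) v)" for j
    by (rule integrable_bounded[of _ 1]) (auto simp: abs_mult H1 hit_bounds intro!: mult_le_one)
  have "(\<lambda>L. (\<Sum>j<L. e j) / real L) \<longlonglongrightarrow> e (c m)"
    by (rule mean_of_eventually_const_tendsto) (rule e_const)
  moreover have "filterlim (\<lambda>k. (4::nat) ^ k) at_top sequentially"
    by (rule filterlim_subseq) (simp add: strict_mono_def)
  ultimately have "(\<lambda>k. (\<Sum>j<4 ^ k. e j) / real (4 ^ k)) \<longlonglongrightarrow> e (c m)"
    by (rule filterlim_compose)
  moreover have "(\<Sum>j<L. e j) / real L = (\<integral>v. H v * row_freq L v (s m) (z m) \<partial>N)" for L
  proof -
    have "(\<integral>v. H v * row_freq L v (s m) (z m) \<partial>N) = (\<integral>v. (\<Sum>j<L. H v * hit (s m) j (z m) v) / L \<partial>N)"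
      by (simp add: row_freq_hit sum_distrib_left)
    then show ?thesis using Hhit by (simp add: e_def)
  qed
  ultimately have "(\<lambda>k. \<integral>v. H v * row_freq (4 ^ k) v (s m) (z m) \<partial>N) \<longlonglongrightarrow> e (c m)"
    by (simp only:)
  moreover have "(\<lambda>k. \<integral>v. H v * row_freq (4 ^ k) v (s m) (z m) \<partial>N)
    \<longlonglongrightarrow> (\<integral>v. H v * limit_freq v (s m) (z m) \<partial>N)"
  proof (rule integral_dominated_convergence[where w="\<lambda>_. 1"])
    show "AE v in N. (\<lambda>k. H v * row_freq (4 ^ k) v (s m) (z m)) \<longlonglongrightarrow> H v * limit_freq v (s m) (z m)"
      using AE_row_freq_tendsto by eventually_elim (intro tendsto_intros, simp)
    show "AE v in N. norm (H v * row_freq (4 ^ k) v (s m) (z m)) \<le> 1" for k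
      by (auto simp: abs_mult H1 row_freq_nonneg row_freq_le_1 intro!: mult_le_one)
  qed auto
  ultimately have "e (c m) = (\<integral>v. H v * limit_freq v (s m) (z m) \<partial>N)"
    by (rule LIMSEQ_unique)
  \<comment> \<open>The new frequency is absorbed into the weight \<open>G\<close>. It is bounded
    and invariant under swaps, so the induction hypothesis, stated for all such \<open>G\<close>,
    applies.\<close>
  also have "\<dots> = (\<integral>v. (G v * limit_freq v (s m) (z m)) * (\<Prod>n<m. hit (s n) (c n) (z n) v) \<partial>N)"
    by (simp add: H_def mult_ac)
  also have "\<dots> = (\<integral>v. (G v * limit_freq v (s m) (z m)) * (\<Prod>n<m. limit_freq v (s n) (z n)) \<partial>N)"
    using Suc.prems(2,3) inj
    by (intro Suc.IH) (auto simp: limit_freq_swap_row abs_mult limit_freq_bounds intro!: mult_le_one)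
  finally show ?case by (simp add: e_def H_def mult_ac)
qed simp

text \<open>Limits of finite sums show only that the total mass \<open>S\<close> is at most 1. Its
  mean is the sum of the probabilities that the first entry of the row equals \<open>z\<close>,
  which is 1, so almost surely no mass escapes.\<close>

lemma AE_limit_freq_has_sum_1: "AE v in N. \<forall>y. (limit_freq v y has_sum 1) UNIV"
proof -
  have "AE v in N. (limit_freq v y has_sum 1) UNIV" for y
  proof -
    define S where "S v = (\<integral>\<^sup>+z. ennreal (limit_freq v y z) \<partial>count_space UNIV)" for v :: "'s \<times> nat \<Rightarrow> 'v"
    have [measurable]: "S \<in> borel_measurable N"
    proof -
      \<comment> \<open>Carried along \<open>to_nat\<close>, the integral over a counting measure
        becomes a series over \<open>nat\<close>, which is measurable term by term.\<close>
      have "S = (\<lambda>v. \<Sum>n. ennreal (if n \<in> range (to_nat :: 'v \<Rightarrow> nat) then limit_freq v y (from_nat n) else 0))"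
      proof
        fix v
        have "S v = (\<integral>\<^sup>+n. ennreal (limit_freq v y (from_nat n)) \<partial>count_space (range (to_nat :: 'v \<Rightarrow> nat)))"
          unfolding S_def
          by (subst nn_integral_bij_count_space[symmetric, of to_nat UNIV "range (to_nat :: 'v \<Rightarrow> nat)"])
            (auto simp: bij_betw_def)
        also have "\<dots> = (\<integral>\<^sup>+n. ennreal (if n \<in> range (to_nat :: 'v \<Rightarrow> nat) then limit_freq v y (from_nat n) else 0) \<partial>count_space UNIV)"
          by (subst nn_integral_count_space_indicator) (auto intro!: nn_integral_cong simp: indicator_def)
        finally show "S v = (\<Sum>n. ennreal (if n \<in> range (to_nat :: 'v \<Rightarrow> nat) then limit_freq v y (from_nat n) else 0))"
          by (simp add: nn_integral_count_space_nat)
      qed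
      then show ?thesis by simp
    qed
    have hit1: "(\<integral>v. limit_freq v y z \<partial>N) = prob {v. v (y, 0) = z}" for z
    proof -
      have "(\<integral>v. hit y 0 z v \<partial>N) = (\<integral>v. limit_freq v y z \<partial>N)"
        using integral_hits_eq_limit_freqs[of "\<lambda>_. 1" "\<lambda>_. y" "\<lambda>_. 0" "Suc 0" "\<lambda>_. z"]
        by (simp add: inj_on_def)
      moreover have "hit y 0 z = indicat_real {v. v (y, 0) = z}" by (auto simp: hit_def indicator_def)
      ultimately show ?thesis by simp
    qed
    have ES: "(\<integral>\<^sup>+v. S v \<partial>N) = 1"
    proof -
      have "(\<integral>\<^sup>+v. S v \<partial>N) = (\<integral>\<^sup>+z. \<integral>\<^sup>+v. ennreal (limit_freq v y z) \<partial>N \<partial>count_space UNIV)"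
        unfolding S_def by (rule nn_integral_count_space_nn_integral) auto
      also have "\<dots> = (\<integral>\<^sup>+z. emeasure N {v. v (y, 0) = z} \<partial>count_space UNIV)"
      proof (rule nn_integral_cong)
        fix z
        have "(\<integral>\<^sup>+v. ennreal (limit_freq v y z) \<partial>N) = ennreal (\<integral>v. limit_freq v y z \<partial>N)"
          by (intro nn_integral_eq_integral integrable_bounded[of _ 1]) (auto simp: limit_freq_bounds)
        then show "(\<integral>\<^sup>+v. ennreal (limit_freq v y z) \<partial>N) = emeasure N {v. v (y, 0) = z}"
          by (simp add: hit1 emeasure_eq_measure)
      qed
      also have "\<dots> = emeasure N (\<Union>z. {v. v (y, 0) = z})"
      proof (rule emeasure_UN_countable[symmetric])
        show "{v. v (y, 0) = z} \<in> sets N" for z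
        proof -
          have "{v \<in> space N. v (y, 0) = z} \<in> sets N" by measurable
          then show ?thesis by simp
        qed
      qed (auto simp: disjoint_family_on_def)
      also have "(\<Union>z. {v. v (y, 0) = z}) = space N" by auto
      finally show ?thesis by (simp only: emeasure_space_1)
    qed
    have sum_le: "AE v in N. limit_freq v y summable_on UNIV \<and> S v = ennreal (infsum (limit_freq v y) UNIV)
        \<and> S v \<le> 1"
      using AE_row_freq_tendsto
    proof eventually_elim
      case (elim v)
      have fin: "sum (limit_freq v y) A \<le> 1" if "finite A" for A
      proof (rule LIMSEQ_le_const2)
        show "(\<lambda>k. \<Sum>z\<in>A. row_freq (4 ^ k) v y z) \<longlonglongrightarrow> sum (limit_freq v y) A"
          using elim by (intro tendsto_sum) auto
      qed (use that in \<open>auto intro: sum_row_freq_le_1\<close>)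
      have summ: "limit_freq v y summable_on UNIV"
        using fin by (intro nonneg_bdd_above_summable_on bdd_aboveI2[of _ _ 1]) (auto simp: limit_freq_bounds)
      then have "Infinite_Sum.abs_summable_on (limit_freq v y) UNIV"
        by (simp add: limit_freq_bounds)
      then have abs: "Infinite_Set_Sum.abs_summable_on (limit_freq v y) UNIV"
        using abs_summable_equivalent by blast
      have "S v = ennreal (infsetsum (limit_freq v y) UNIV)"
        unfolding S_def by (rule nn_integral_conv_infsetsum[OF abs]) (simp add: limit_freq_bounds)
      then have S: "S v = ennreal (infsum (limit_freq v y) UNIV)"
        using infsetsum_infsum[OF abs] by simp
      moreover have "infsum (limit_freq v y) UNIV \<le> 1"
        using summ fin by (intro infsum_le_finite_sums) auto
      ultimately show ?case using summ by (simp add: ennreal_le_1)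
    qed
    have "(\<integral>\<^sup>+v. 1 - S v \<partial>N) = (\<integral>\<^sup>+v. 1 \<partial>N) - (\<integral>\<^sup>+v. S v \<partial>N)"
      using sum_le by (intro nn_integral_diff) (auto simp: ES elim!: eventually_mono)
    also have "\<dots> = 0" by (simp add: ES emeasure_space_1[simplified])
    finally have "AE v in N. 1 - S v = 0" by (subst (asm) nn_integral_0_iff_AE) auto
    with sum_le show ?thesis
    proof eventually_elim
      case (elim v)
      then have "S v = 1" by (auto intro: antisym simp: diff_eq_0_iff_ennreal)
      then have "infsum (limit_freq v y) UNIV = 1"
        using elim by (metis ennreal_eq_1)
      then show ?case using elim has_sum_infsum by metis
    qed
  qed
  then show ?thesis by (simp add: AE_all_countable)
qed

end

section \<open>From hidden Markov models to mixtures\<close>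

text \<open>Following a prescribed path reads one entry per step. Its position depends on
  \<open>s\<close> alone and not on \<omega>, so a path event becomes a condition on fixed entries
  of the array.\<close>

lemma path_eq_iff_successors:
  assumes "Y 0 \<omega> = s 0"
  shows "(\<forall>n\<in>{1..K}. Y n \<omega> = s n) \<longleftrightarrow>
    (\<forall>n<K. successors Y \<omega> (s n, card {i. i < n \<and> s i = s n}) = Some (s (Suc n)))" (is "?L \<longleftrightarrow> ?R")
proof -
  have succ: "successors Y \<omega> (s n, card {i. i < n \<and> s i = s n}) = Some (Y (Suc n) \<omega>)"
    if "\<forall>i\<le>n. Y i \<omega> = s i" for n
  proof -
    have "{i. i < n \<and> Y i \<omega> = Y n \<omega>} = {i. i < n \<and> s i = s n}" using that by auto
    then show ?thesis using successors_at_visit[of Y \<omega> n] that by simp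
  qed
  show ?thesis
  proof
    assume L: ?L
    show ?R
    proof (intro allI impI)
      fix n assume "n < K"
      have "Y i \<omega> = s i" if "i \<le> Suc n" for i
        using L assms that \<open>n < K\<close> by (cases i) auto
      then show "successors Y \<omega> (s n, card {i. i < n \<and> s i = s n}) = Some (s (Suc n))"
        using succ[of n] by simp
    qed
  next
    assume R: ?R
    have "\<forall>i\<le>n. Y i \<omega> = s i" if "n \<le> K" for n
      using that
    proof (induction n)
      case (Suc n)
      then show ?case using succ[of n] R by (auto simp: le_Suc_eq)
    qed (simp add: assms)
    then show ?L by auto
  qed
qed

text \<open>No entry is read twice: each new visit to a state raises its count. This supplies the
  distinct positions that the replacement of entries by frequencies requires.\<close>

lemma inj_on_visit_index: "inj_on (\<lambda>n. (s n, card {i. i < n \<and> s i = s n})) A" for s :: "nat \<Rightarrow> 's"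
proof (rule linorder_inj_onI)
  fix n m :: nat assume "n < m"
  show "(s n, card {i. i < n \<and> s i = s n}) \<noteq> (s m, card {i. i < m \<and> s i = s m})"
  proof
    assume eq: "(s n, card {i. i < n \<and> s i = s n}) = (s m, card {i. i < m \<and> s i = s m})"
    have "{i. i < n \<and> s i = s n} \<subset> {i. i < m \<and> s i = s m}"
      using \<open>n < m\<close> eq by auto
    then have "card {i. i < n \<and> s i = s n} < card {i. i < m \<and> s i = s m}"
      by (rule psubset_card_mono[rotated]) simp
    then show False using eq by simp
  qed
qed auto

section \<open>Stochastic matrices on the extended state space\<close>

lemma transition_matrix_id: "transition_matrix (\<lambda>i j. if j = i then 1 else 0)"
  unfolding transition_matrix_def
proof (intro allI conjI)
  fix i :: 'a
  show "((\<lambda>j. if j = i then 1 else 0 :: real) has_sum 1) UNIV"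
    by (rule has_sum_finite_neutralI[of "{i}"]) auto
qed auto

text \<open>The frequencies supply rows for proper states only; the extra point is made absorbing to
  complete a stochastic matrix.\<close>

definition extend_matrix :: "('s \<Rightarrow> 's option \<Rightarrow> real) \<Rightarrow> 's option \<Rightarrow> 's option \<Rightarrow> real" where
  "extend_matrix f i j = (case i of None \<Rightarrow> if j = None then 1 else 0 | Some y \<Rightarrow> f y j)"

lemma extend_matrix_Some [simp]: "extend_matrix f (Some y) j = f y j"
  by (simp add: extend_matrix_def)

lemma transition_matrix_extend_matrix:
  assumes "\<And>y j. 0 \<le> f y j" "\<And>y. (f y has_sum 1) UNIV"
  shows "transition_matrix (extend_matrix f)"
  unfolding transition_matrix_def
proof (intro allI conjI)
  fix i j
  show "0 \<le> extend_matrix f i j" using assms by (auto simp: extend_matrix_def split: option.split)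
  have "extend_matrix f None = (\<lambda>j. if j = None then 1 else 0)" by (auto simp: extend_matrix_def)
  moreover have "((\<lambda>j. if j = None then 1 else 0 :: real) has_sum 1) (UNIV :: 'a option set)"
    by (rule has_sum_finite_neutralI[of "{None}"]) auto
  moreover have "extend_matrix f (Some y) = f y" for y by (auto simp: extend_matrix_def)
  ultimately show "(extend_matrix f i has_sum 1) UNIV" using assms(2) by (cases i) auto
qed

lemma row_exchangeable_successors:
  fixes Y :: "nat \<Rightarrow> 'a \<Rightarrow> 's::countable"
  assumes "prob_space M"
    and meas: "\<And>n. Y n \<in> measurable M (count_space UNIV)"
    and pe: "partially_exchangeable M Y"
  shows "row_exchangeable (distr M array_space (successors Y))"
proof -
  interpret prob_space M by fact
  have V [measurable]: "successors Y \<in> measurable M array_space" by (rule measurable_successors) (rule meas)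
  interpret N: prob_space "distr M array_space (successors Y)" by (rule prob_space_distr) (rule V)
  show ?thesis
  proof
    fix y i j
    have swap: "swap_row y i j \<in> measurable array_space (array_space :: ('s \<times> nat \<Rightarrow> 's option) measure)"
    proof (rule measurable_PiM_single')
      show "(\<lambda>v. swap_row y i j v p) \<in> measurable array_space (count_space UNIV)" for p
        by (cases p) (simp add: swap_row_def)
    qed auto
    let ?\<pi> = "\<lambda>y'. if y' = y then Transposition.transpose i j else id"
    have "distr (distr M array_space (successors Y)) array_space (swap_row y i j)
      = distr M array_space (swap_row y i j \<circ> successors Y)"
      by (rule distr_distr[OF swap V])
    also have "swap_row y i j \<circ> successors Y = (\<lambda>\<omega> (y', n). successors Y \<omega> (y', ?\<pi> y' n))"
      by (auto simp: swap_row_def fun_eq_iff)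
    also have "distr M array_space \<dots> = distr M array_space (successors Y)"
      by (rule pe[unfolded partially_exchangeable_def, THEN spec, THEN mp,
        OF transpose_row_perms[unfolded row_perms_def mem_Collect_eq]])
    finally show "distr (distr M array_space (successors Y)) array_space (swap_row y i j)
      = distr M array_space (successors Y)" .
  qed simp
qed

lemma measurable_limit_freq_array:
  "(\<lambda>v. limit_freq v y z) \<in> borel_measurable (array_space :: ('s::countable \<times> nat \<Rightarrow> 'v::countable) measure)"
proof -
  have [measurable]: "(\<lambda>v. v p) \<in> measurable (array_space :: ('s \<times> nat \<Rightarrow> 'v) measure) (count_space UNIV)" for p
    by (rule measurable_component_singleton) simp
  show ?thesis unfolding limit_freq_def row_freq_def by measurable
qed

text \<open>The zero-one law decides, given \<open>X 1 = x\<close>, whether an entry is below a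
  rational threshold. Countably many such decisions determine the whole family of limits, so it is a
  function of \<open>x\<close>.\<close>

lemma (in hmm) limit_freq_countably_valued:
  assumes rec: "recurrent_chain Q X"
  obtains p :: "'x \<Rightarrow> 's \<Rightarrow> 's option \<Rightarrow> real"
    where "AE \<omega> in Q. limit_freq (successors Z \<omega>) \<in> range p"
proof -
  define B where "B y z r = {w \<in> space (path_space :: (nat \<Rightarrow> 'x \<times> 's) measure). limit_freq (successors (\<lambda>n w. snd (w n)) w) y z \<le> real_of_rat r}"
    for y :: 's and z and r :: rat
  have B: "B y z r \<in> sets (path_space :: (nat \<Rightarrow> 'x \<times> 's) measure)" for y z r
  proof -
    have "(\<lambda>w. snd (w n)) \<in> measurable (path_space :: (nat \<Rightarrow> 'x \<times> 's) measure) (count_space UNIV)" for n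
      by (rule measurable_compose[OF measurable_path_component]) simp
    then have [measurable]: "successors (\<lambda>n w. snd (w n)) \<in> measurable (path_space :: (nat \<Rightarrow> 'x \<times> 's) measure) array_space"
      by (rule measurable_successors)
    note [measurable] = measurable_limit_freq_array
    show ?thesis unfolding B_def by measurable
  qed
  have path: "successors (\<lambda>n w. snd (w n)) w = successors (\<lambda>n w. w n) (\<lambda>n. snd (w n))" for w :: "nat \<Rightarrow> 'x \<times> 's"
    by (rule successors_path)
  have inv: "(\<lambda>n. w (Suc n)) \<in> B y z r \<longleftrightarrow> w \<in> B y z r" for w y z r
    using limit_freq_successors_shift[of "\<lambda>n. snd (w n)"]
    by (simp add: B_def space_PiM path)
  have WB: "(\<lambda>n. W n \<omega>) \<in> B y z r \<longleftrightarrow> limit_freq (successors Z \<omega>) y z \<le> real_of_rat r" for \<omega> y z r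
    by (simp add: B_def space_PiM W_def path successors_path[of Z \<omega>])
  define \<tau> where "\<tau> x y z r \<longleftrightarrow> (AE \<omega> in Q. X 1 \<omega> = x \<longrightarrow> (\<lambda>n. W n \<omega>) \<in> B y z r)" for x y z r
  \<comment> \<open>At a state that is null at time 1, \<tau> holds vacuously for every
    \<open>r\<close> and no such \<open>f\<close> exists. The junk value of \<open>p\<close> there
    does not matter, because \<open>X 1\<close> almost surely avoids these states.\<close>
  define p where "p x = (SOME f. \<forall>y z r. f y z \<le> real_of_rat r \<longleftrightarrow> \<tau> x y z r)" for x
  have pos: "AE \<omega> in Q. \<P>(\<omega>' in Q. X 1 \<omega>' = X 1 \<omega>) > 0"
  proof -
    have "AE \<omega> in Q. X 1 \<omega> = x \<longrightarrow> \<P>(\<omega>' in Q. X 1 \<omega>' = x) > 0" for x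
    proof (cases "\<P>(\<omega>' in Q. X 1 \<omega>' = x) = 0")
      case True
      then have "AE \<omega> in Q. \<not> X 1 \<omega> = x" by (subst (asm) prob_Collect_eq_0) simp_all
      then show ?thesis by eventually_elim simp
    next
      case False
      then show ?thesis by (simp add: zero_less_measure_iff)
    qed
    then have "AE \<omega> in Q. \<forall>x. X 1 \<omega> = x \<longrightarrow> \<P>(\<omega>' in Q. X 1 \<omega>' = x) > 0"
      unfolding AE_all_countable by blast
    then show ?thesis by eventually_elim simp
  qed
  have "AE \<omega> in Q. \<P>(\<omega>' in Q. X 1 \<omega>' = x) > 0 \<longrightarrow> X 1 \<omega> = x \<longrightarrow>
    (limit_freq (successors Z \<omega>) y z \<le> real_of_rat r \<longleftrightarrow> \<tau> x y z r)" for x y z r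
  proof (cases "\<P>(\<omega>' in Q. X 1 \<omega>' = x) > 0")
    case True
    show ?thesis
    proof (cases "\<tau> x y z r")
      case True
      then have "AE \<omega> in Q. X 1 \<omega> = x \<longrightarrow> limit_freq (successors Z \<omega>) y z \<le> real_of_rat r"
        by (simp add: \<tau>_def WB)
      then show ?thesis by eventually_elim (use True in simp)
    next
      case False
      then have "AE \<omega> in Q. X 1 \<omega> = x \<longrightarrow> (\<lambda>n. W n \<omega>) \<notin> B y z r"
        using shift_invariant_zero_one[OF rec True B inv, of y z r] by (simp add: \<tau>_def)
      then show ?thesis unfolding WB by eventually_elim (use False in simp)
    qed
  qed simp
  then have "AE \<omega> in Q. \<forall>x y z r. \<P>(\<omega>' in Q. X 1 \<omega>' = x) > 0 \<longrightarrow> X 1 \<omega> = x \<longrightarrow>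
    (limit_freq (successors Z \<omega>) y z \<le> real_of_rat r \<longleftrightarrow> \<tau> x y z r)"
    unfolding AE_all_countable by blast
  with pos have "AE \<omega> in Q. limit_freq (successors Z \<omega>) \<in> range p"
  proof eventually_elim
    case (elim \<omega>)
    let ?f = "limit_freq (successors Z \<omega>)"
    have f: "\<forall>y z r. ?f y z \<le> real_of_rat r \<longleftrightarrow> \<tau> (X 1 \<omega>) y z r" using elim by blast
    then have "\<forall>y z r. p (X 1 \<omega>) y z \<le> real_of_rat r \<longleftrightarrow> \<tau> (X 1 \<omega>) y z r"
      unfolding p_def by (rule someI[of "\<lambda>f. \<forall>y z r. f y z \<le> real_of_rat r \<longleftrightarrow> \<tau> (X 1 \<omega>) y z r"])
    with f have eq: "?f y z \<le> real_of_rat r \<longleftrightarrow> p (X 1 \<omega>) y z \<le> real_of_rat r" for y z r by blast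
    have "?f y z = p (X 1 \<omega>) y z" for y z
    proof (rule ccontr)
      assume "?f y z \<noteq> p (X 1 \<omega>) y z"
      then consider "?f y z < p (X 1 \<omega>) y z" | "p (X 1 \<omega>) y z < ?f y z" by linarith
      then show False
      proof cases
        case 1
        from of_rat_dense[OF this] show False using eq[of y z] by (meson less_imp_le not_less)
      next
        case 2
        from of_rat_dense[OF this] show False using eq[of y z] by (meson less_imp_le not_less)
      qed
    qed
    then have "?f = p (X 1 \<omega>)" by blast
    then show ?case by blast
  qed
  then show thesis by (rule that)
qed

lemma measure_distr_cylinder:
  fixes U :: "nat \<Rightarrow> 'z \<Rightarrow> 's" and n :: nat
  assumes "\<And>i. U i \<in> measurable K (count_space UNIV)"
  shows "measure (distr K (\<Pi>\<^sub>M _\<in>{..<n}. count_space UNIV) (\<lambda>\<omega>. \<lambda>i\<in>{..<n}. U i \<omega>))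
      {f \<in> space (\<Pi>\<^sub>M _\<in>{..<n}. count_space UNIV). \<forall>i\<in>{..<n}. f i = w i}
    = \<P>(\<omega> in K. \<forall>i<n. U i \<omega> = w i)"
proof -
  let ?S = "(\<Pi>\<^sub>M _\<in>{..<n}. count_space UNIV) :: (nat \<Rightarrow> 's) measure"
  have C: "{f \<in> space ?S. \<forall>i\<in>{..<n}. f i = w i} \<in> sets ?S"
  proof (rule sets.sets_Collect_finite_All)
    show "{f \<in> space ?S. f i = w i} \<in> sets ?S" if "i \<in> {..<n}" for i
      using measurable_sets[OF measurable_component_singleton[OF that], of "{w i}" "\<lambda>_. count_space UNIV"]
      by (simp add: vimage_def Int_def conj_commute)
  qed simp
  have U: "(\<lambda>\<omega>. \<lambda>i\<in>{..<n}. U i \<omega>) \<in> measurable K ?S"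
    using assms by (intro measurable_restrict) auto
  show ?thesis
    by (subst measure_distr[OF U C]) (auto intro!: arg_cong[where f="measure K"] simp: space_PiM)
qed

text \<open>The mixing matrix comes from exchangeability of the array; the hidden chain enters only
  at the end, to show that this matrix is almost surely countably valued.\<close>

lemma recurrent_hmm_imp_countable_mixture:
  fixes Y :: "nat \<Rightarrow> 'a \<Rightarrow> 's::countable"
  assumes "prob_space M"
    and meas [measurable]: "\<And>n. Y n \<in> measurable M (count_space UNIV)"
    and pe: "partially_exchangeable M Y"
    and start: "\<P>(\<omega> in M. Y 0 \<omega> = y\<^sub>0) = 1"
    and rhmm: "recurrent_hmm M Y"
  shows "countable_markov_mixture M Y y\<^sub>0"
proof -
  interpret prob_space M by fact
  define V where "V = successors Y"
  have V [measurable]: "V \<in> measurable M array_space"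
    unfolding V_def by (rule measurable_successors) (rule meas)
  define N where "N = distr M array_space V"
  interpret N: row_exchangeable N
    unfolding N_def V_def by (rule row_exchangeable_successors[OF assms(1) meas pe])
  note [measurable] = measurable_limit_freq_array
  have Y0: "AE \<omega> in M. Y 0 \<omega> = y\<^sub>0"
    using start by (subst (asm) prob_Collect_eq_1) simp_all
  define L where "L \<omega> = extend_matrix (limit_freq (V \<omega>))" for \<omega>
  have extend_measurable: "(\<lambda>v. extend_matrix (limit_freq v)) \<in> measurable array_space (matrix_space :: ('s option \<Rightarrow> 's option \<Rightarrow> real) measure)"
  proof (intro measurable_PiM_single')
    fix i j :: "'s option"
    show "(\<lambda>v. extend_matrix (limit_freq v) i j) \<in> borel_measurable array_space"
      by (cases i) (simp_all add: extend_matrix_def)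
  qed (auto simp: space_PiM)
  have "AE v in N. transition_matrix (extend_matrix (limit_freq v))"
    using N.AE_limit_freq_has_sum_1
    by eventually_elim (auto intro!: transition_matrix_extend_matrix simp: limit_freq_bounds)
  then have "AE \<omega> in M. transition_matrix (L \<omega>)"
    unfolding N_def L_def by (rule AE_distrD[OF V])
  then obtain E where E: "{\<omega> \<in> space M. \<not> transition_matrix (L \<omega>)} \<subseteq> E" "E \<in> null_sets M"
    by (auto elim!: AE_E simp: null_sets_def)
  have [measurable]: "E \<in> sets M" using E by auto
  \<comment> \<open>The rows of \<open>L\<close> sum to 1 almost surely, but a stochastic matrix is
    required at every point; on the null set \<open>E\<close> the identity matrix is
    substituted.\<close>
  define P where "P \<omega> = (if \<omega> \<in> E then (\<lambda>i j. if j = i then 1 else 0) else L \<omega>)" for \<omega>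
  have PL: "AE \<omega> in M. P \<omega> = L \<omega>"
    using AE_not_in[OF E(2)] by eventually_elim (simp add: P_def)
  have P [measurable]: "P \<in> measurable M matrix_space"
    unfolding P_def L_def
    by (intro measurable_If_set measurable_compose[OF V extend_measurable]) (auto simp: space_PiM)
  have trans: "transition_matrix (P \<omega>)" if "\<omega> \<in> space M" for \<omega>
    using E(1) that transition_matrix_id by (auto simp: P_def)
  let ?F = "vimage_algebra (space M) P matrix_space"
  have Pspace: "P \<in> space M \<rightarrow> space matrix_space" by (auto simp: space_PiM)
  have "subalgebra M ?F"
    unfolding subalgebra_def
    by (auto simp: sets_vimage_algebra2[OF Pspace] intro: measurable_sets)
  then interpret finite_measure_subalgebra M ?F by unfold_locales
  have entry [measurable]: "(\<lambda>\<omega>. P \<omega> i j) \<in> borel_measurable M" for i j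
    by (rule measurable_compose[OF P measurable_matrix_entry])
  have P01: "0 \<le> P \<omega> i j" "P \<omega> i j \<le> 1" for \<omega> i j
    by (auto simp: P_def L_def extend_matrix_def limit_freq_bounds split: option.split)
  have prod_int: "integrable M (\<lambda>\<omega>. \<Prod>n<K. P \<omega> (y n) (y (Suc n)))" for K y
    by (rule integrable_const_bound[of _ 1]) (auto simp: abs_prod P01 intro!: prod_le_1)
  \<comment> \<open>Events generated by \<open>P\<close> are almost surely events of the limiting
    frequencies. Their indicators are invariant under swaps and can serve as the weight
    \<open>G\<close>, which yields the test identity for conditional expectation.\<close>
  have mixed: "(\<integral>\<omega>. indicat_real D (P \<omega>) * (\<Prod>n<K. if V \<omega> (s n, card {i. i < n \<and> s i = s n}) = z n then 1 else 0) \<partial>M)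
    = (\<integral>\<omega>. indicat_real D (P \<omega>) * (\<Prod>n<K. P \<omega> (Some (s n)) (z n)) \<partial>M)"
    if D: "D \<in> sets matrix_space" for D K and s :: "nat \<Rightarrow> 's" and z
  proof -
    let ?G = "\<lambda>v. indicat_real D (extend_matrix (limit_freq v))"
    have G [measurable]: "?G \<in> borel_measurable array_space"
      using measurable_compose[OF extend_measurable borel_measurable_indicator[OF D]] .
    have GN: "?G \<in> borel_measurable N" using G by measurable
    have [measurable]: "(\<lambda>v. v p) \<in> measurable (array_space :: ('s \<times> nat \<Rightarrow> 's option) measure) (count_space UNIV)" for p
      by (rule measurable_component_singleton) simp
    have "(\<integral>\<omega>. indicat_real D (P \<omega>) * (\<Prod>n<K. if V \<omega> (s n, card {i. i < n \<and> s i = s n}) = z n then 1 else 0) \<partial>M)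
      = (\<integral>\<omega>. ?G (V \<omega>) * (\<Prod>n<K. N.hit (s n) (card {i. i < n \<and> s i = s n}) (z n) (V \<omega>)) \<partial>M)"
      by (rule integral_cong_AE) (use PL D in \<open>auto elim!: eventually_mono simp: L_def N.hit_def\<close>)
    also have "\<dots> = (\<integral>v. ?G v * (\<Prod>n<K. N.hit (s n) (card {i. i < n \<and> s i = s n}) (z n) v) \<partial>N)"
      unfolding N_def by (rule integral_distr[symmetric]) (simp_all add: N.hit_def)
    also have "\<dots> = (\<integral>v. ?G v * (\<Prod>n<K. limit_freq v (s n) (z n)) \<partial>N)"
      by (rule N.integral_hits_eq_limit_freqs[OF GN])
        (auto simp: limit_freq_swap_row inj_on_visit_index indicator_def)
    also have "\<dots> = (\<integral>\<omega>. ?G (V \<omega>) * (\<Prod>n<K. limit_freq (V \<omega>) (s n) (z n)) \<partial>M)"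
      unfolding N_def by (rule integral_distr) simp_all
    also have "\<dots> = (\<integral>\<omega>. indicat_real D (P \<omega>) * (\<Prod>n<K. P \<omega> (Some (s n)) (z n)) \<partial>M)"
      by (rule integral_cong_AE) (use PL D in \<open>auto elim!: eventually_mono simp: L_def\<close>)
    finally show ?thesis .
  qed
  have "AE \<omega> in M. real_cond_exp M ?F (indicator {\<omega> \<in> space M. \<forall>n\<in>{1..K}. Some (Y n \<omega>) = y n}) \<omega>
           = (\<Prod>n<K. P \<omega> (y n) (y (Suc n)))" if y0: "y 0 = Some y\<^sub>0" for K y
  proof (rule real_cond_exp_charact)
    let ?C = "{\<omega> \<in> space M. \<forall>n\<in>{1..K}. Some (Y n \<omega>) = y n}"
    have C [measurable]: "?C \<in> sets M" by measurable
    show "integrable M (indicat_real ?C)" by (simp add: integrable_indicator_iff emeasure_eq_measure)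
    show "integrable M (\<lambda>\<omega>. \<Prod>n<K. P \<omega> (y n) (y (Suc n)))" by (rule prod_int)
    have "(\<lambda>\<omega>. P \<omega> i j) \<in> borel_measurable ?F" for i j
      by (rule measurable_compose[OF measurable_vimage_algebra1[OF Pspace] measurable_matrix_entry])
    then show "(\<lambda>\<omega>. \<Prod>n<K. P \<omega> (y n) (y (Suc n))) \<in> borel_measurable ?F" by measurable
    fix A assume "A \<in> sets ?F"
    then obtain D where D: "D \<in> sets matrix_space" and A: "A = P -` D \<inter> space M"
      by (auto simp: sets_vimage_algebra2[OF Pspace])
    have AM [measurable]: "A \<in> sets M" unfolding A using D by measurable
    define s where "s n = the (y n)" for n
    show "(\<integral>\<omega>\<in>A. indicat_real ?C \<omega> \<partial>M) = (\<integral>\<omega>\<in>A. (\<Prod>n<K. P \<omega> (y n) (y (Suc n))) \<partial>M)"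
    proof (cases "\<forall>n\<le>K. y n \<noteq> None")
      case True
      then have ys: "y n = Some (s n)" if "n \<le> K" for n using that by (auto simp: s_def)
      have "(\<integral>\<omega>\<in>A. indicat_real ?C \<omega> \<partial>M) = (\<integral>\<omega>. indicat_real D (P \<omega>) *
        (\<Prod>n<K. if V \<omega> (s n, card {i. i < n \<and> s i = s n}) = y (Suc n) then 1 else 0) \<partial>M)"
        unfolding set_lebesgue_integral_def
      proof (rule integral_cong_AE)
        show "AE \<omega> in M. indicat_real A \<omega> *\<^sub>R indicat_real ?C \<omega> = indicat_real D (P \<omega>) *
          (\<Prod>n<K. if V \<omega> (s n, card {i. i < n \<and> s i = s n}) = y (Suc n) then 1 else 0)"
          using Y0 AE_space
        proof eventually_elim
          case (elim \<omega>)
          have "\<omega> \<in> ?C \<longleftrightarrow> (\<forall>n\<in>{1..K}. Y n \<omega> = s n)" using elim ys by auto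
          also have "\<dots> \<longleftrightarrow> (\<forall>n<K. V \<omega> (s n, card {i. i < n \<and> s i = s n}) = y (Suc n))"
            unfolding V_def
            by (subst path_eq_iff_successors) (use elim ys y0 in \<open>auto simp: s_def\<close>)
          finally have "indicat_real ?C \<omega> = (\<Prod>n<K. if V \<omega> (s n, card {i. i < n \<and> s i = s n}) = y (Suc n) then 1 else 0)"
            by (auto simp: indicator_def prod_zero_iff)
          then show ?case using elim by (simp add: A indicator_def)
        qed
      qed (use D V in measurable)
      also have "\<dots> = (\<integral>\<omega>. indicat_real D (P \<omega>) * (\<Prod>n<K. P \<omega> (Some (s n)) (y (Suc n))) \<partial>M)"
        by (rule mixed[OF D])
      also have "\<dots> = (\<integral>\<omega>\<in>A. (\<Prod>n<K. P \<omega> (y n) (y (Suc n))) \<partial>M)"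
        unfolding set_lebesgue_integral_def
        by (rule Bochner_Integration.integral_cong) (auto simp: A indicator_def ys)
      finally show ?thesis .
    next
      case False
      \<comment> \<open>Y never takes the value \<open>None\<close>, so the product must vanish
        almost surely. Up to the first index \<open>k\<close> with \<open>y k = None\<close> the
        path is proper, and the entry read at an actual visit is never \<open>None\<close>; hence
        the product of entry indicators is 0. Taking \<open>D = UNIV\<close> in \<open>mixed\<close>
        transfers this to the product of matrix entries, which is nonnegative.\<close>
      define k where "k = (LEAST k. y k = None)"
      have k: "y k = None" unfolding k_def by (rule LeastI_ex) (use False in auto)
      have less_k: "y n = Some (s n)" if "n < k" for n
        using not_less_Least[of n "\<lambda>k. y k = None"] that by (auto simp: k_def s_def)
      have "k \<le> K" using False unfolding k_def by (meson Least_le order_trans)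
      have "k \<noteq> 0" using k y0 by (metis option.distinct(1))
      then obtain l where l: "k = Suc l" by (cases k) auto
      have "AE \<omega> in M. (\<Prod>n<k. if V \<omega> (s n, card {i. i < n \<and> s i = s n}) = y (Suc n) then 1 else 0) = (0::real)"
        using Y0
      proof eventually_elim
        case (elim \<omega>)
        have "\<not> (\<forall>n<k. V \<omega> (s n, card {i. i < n \<and> s i = s n}) = y (Suc n))"
        proof
          assume *: "\<forall>n<k. V \<omega> (s n, card {i. i < n \<and> s i = s n}) = y (Suc n)"
          then have "\<forall>n<l. successors Y \<omega> (s n, card {i. i < n \<and> s i = s n}) = Some (s (Suc n))"
            using less_k by (simp add: l V_def)
          then have "\<forall>n\<in>{1..l}. Y n \<omega> = s n"
            by (subst path_eq_iff_successors) (use elim y0 in \<open>auto simp: s_def\<close>)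
          then have Ys: "Y n \<omega> = s n" if "n \<le> l" for n
            using elim y0 that by (cases n) (auto simp: s_def)
          then have "{i. i < l \<and> Y i \<omega> = Y l \<omega>} = {i. i < l \<and> s i = s l}" by auto
          then have "V \<omega> (s l, card {i. i < l \<and> s i = s l}) \<noteq> None"
            using successors_at_visit[of Y \<omega> l] Ys[of l] by (simp add: V_def)
          then show False using * k by (simp add: l)
        qed
        then show ?case by (auto simp: prod_zero_iff)
      qed
      then have "(\<integral>\<omega>. indicat_real UNIV (P \<omega>) * (\<Prod>n<k. if V \<omega> (s n, card {i. i < n \<and> s i = s n}) = y (Suc n) then 1 else 0) \<partial>M) = 0"
        by (intro integral_eq_zero_AE) (auto elim!: eventually_mono)
      then have "(\<integral>\<omega>. (\<Prod>n<k. P \<omega> (Some (s n)) (y (Suc n))) \<partial>M) = 0"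
        by (subst (asm) mixed) (use sets.top[of matrix_space] in \<open>auto simp: space_PiM\<close>)
      then have "(\<integral>\<omega>. (\<Prod>n<k. P \<omega> (y n) (y (Suc n))) \<partial>M) = 0"
        by (simp add: less_k)
      then have "AE \<omega> in M. (\<Prod>n<k. P \<omega> (y n) (y (Suc n))) = 0"
        by (subst (asm) integral_nonneg_eq_0_iff_AE[OF prod_int]) (auto intro!: prod_nonneg simp: P01)
      then have zero: "AE \<omega> in M. (\<Prod>n<K. P \<omega> (y n) (y (Suc n))) = 0"
        by eventually_elim (use \<open>k \<le> K\<close> in \<open>force simp: prod_zero_iff\<close>)
      have "(\<integral>\<omega>\<in>A. (\<Prod>n<K. P \<omega> (y n) (y (Suc n))) \<partial>M) = 0"
        unfolding set_lebesgue_integral_def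
        by (intro integral_eq_zero_AE) (use zero in \<open>auto elim!: eventually_mono\<close>)
      moreover have "?C = {}" using k \<open>k \<le> K\<close> \<open>k \<noteq> 0\<close> by (auto intro!: bexI[of _ k])
      ultimately show ?thesis by simp
    qed
  qed
  then have mixture: "markov_mixture_by M Y y\<^sub>0 P"
    unfolding markov_mixture_by_def using trans by auto

  obtain Q :: "(nat \<Rightarrow> nat \<times> 's) measure" and X :: "nat \<Rightarrow> (nat \<Rightarrow> nat \<times> 's) \<Rightarrow> nat" and Z
    where rep: "hmm_representation M Y Q X Z" and rec: "recurrent_chain Q X"
    using rhmm by (auto simp: recurrent_hmm_def)
  interpret Q: hmm Q X Z
    by (intro hmm.intro hmm_axioms.intro; use rep in \<open>unfold hmm_representation_def, blast\<close>)
  obtain p :: "nat \<Rightarrow> 's \<Rightarrow> 's option \<Rightarrow> real"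
    where p: "AE \<omega> in Q. limit_freq (successors Z \<omega>) \<in> range p"
    using Q.limit_freq_countably_valued[OF rec] .
  \<comment> \<open>Written with entrywise equations so that measurability reduces to countably many
    coordinate conditions.\<close>
  define B where "B = {w \<in> space path_space. \<exists>x. \<forall>y z. limit_freq (successors (\<lambda>n w. w n) w) y z = p x y z}"
  have B: "B \<in> sets path_space"
  proof -
    have [measurable]: "successors (\<lambda>n w. w n) \<in> measurable (path_space :: (nat \<Rightarrow> 's) measure) array_space"
      by (rule measurable_successors) (rule measurable_path_component)
    show ?thesis unfolding B_def by measurable
  qed
  have YB: "(\<lambda>n. Y n \<omega>) \<in> B \<longleftrightarrow> limit_freq (V \<omega>) \<in> range p" for \<omega>
    by (auto simp: B_def space_PiM V_def successors_path[of Y \<omega>] fun_eq_iff image_iff)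
  have ZB: "(\<lambda>n. Z n \<omega>) \<in> B \<longleftrightarrow> limit_freq (successors Z \<omega>) \<in> range p" for \<omega>
    by (auto simp: B_def space_PiM successors_path[of Z \<omega>] fun_eq_iff image_iff)
  have [measurable]: "(\<lambda>\<omega> n. Y n \<omega>) \<in> measurable M path_space" "(\<lambda>\<omega> n. Z n \<omega>) \<in> measurable Q path_space"
    by (auto intro!: measurable_PiM_single')
  have "\<P>(\<omega> in M. True \<and> (\<lambda>n. Y n \<omega>) \<in> B) = 1 * \<P>(\<omega> in Q. True \<and> (\<lambda>n. Z n \<omega>) \<in> B)"
  proof (rule path_law_eqI[OF finite_measure_axioms Q.finite_measure_axioms _ _ _ _ _ _ B])
    fix n :: nat and w :: "nat \<Rightarrow> 's"
    let ?S = "(\<Pi>\<^sub>M _\<in>{..<n}. count_space UNIV) :: (nat \<Rightarrow> 's) measure"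
    have "distr M ?S (\<lambda>\<omega>. \<lambda>i\<in>{..<n}. Y i \<omega>) = distr Q ?S (\<lambda>\<omega>. \<lambda>i\<in>{..<n}. Z i \<omega>)"
      using rep by (simp add: hmm_representation_def)
    then show "\<P>(\<omega> in M. True \<and> (\<forall>i<n. Y i \<omega> = w i)) = 1 * \<P>(\<omega> in Q. True \<and> (\<forall>i<n. Z i \<omega> = w i))"
      using measure_distr_cylinder[where U=Y and K=M and n=n and w=w, OF meas] measure_distr_cylinder[where U=Z and K=Q and n=n and w=w, OF Q.measurable_Z]
      by simp
  qed auto
  moreover have "\<P>(\<omega> in Q. (\<lambda>n. Z n \<omega>) \<in> B) = 1"
    by (subst Q.prob_Collect_eq_1) (use p B in \<open>auto simp: ZB[symmetric]\<close>)
  ultimately have "\<P>(\<omega> in M. (\<lambda>n. Y n \<omega>) \<in> B) = 1" by simp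
  then have "AE \<omega> in M. (\<lambda>n. Y n \<omega>) \<in> B"
    by (subst (asm) prob_Collect_eq_1) (use B in auto)
  then have "AE \<omega> in M. limit_freq (V \<omega>) \<in> range p"
    by (simp only: YB)
  \<comment> \<open>\<open>range p\<close> may contain junk families that are not stochastic, so the
    countable set is cut down to transition matrices; \<open>P\<close> stays in it because its
    values are stochastic everywhere.\<close>
  then have "AE \<omega> in M. P \<omega> \<in> {R \<in> extend_matrix ` range p. transition_matrix R}"
    using PL AE_space
  proof eventually_elim
    case (elim \<omega>)
    then have "P \<omega> \<in> extend_matrix ` range p" by (auto simp: L_def)
    moreover have "transition_matrix (P \<omega>)" using trans elim by blast
    ultimately show ?case by blast
  qed
  moreover have "countable {R \<in> extend_matrix ` range p. transition_matrix R}"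
    by (rule countable_subset[of _ "extend_matrix ` range p"]) auto
  ultimately show ?thesis
    unfolding countable_markov_mixture_def using mixture
    by (intro exI[of _ P] conjI exI[of _ "{R \<in> extend_matrix ` range p. transition_matrix R}"]) auto
qed

theorem theorem3p3:
  fixes M :: "'a measure" and Y :: "nat \<Rightarrow> 'a \<Rightarrow> 's::countable" and y\<^sub>0 :: 's
  assumes "prob_space M"
    and "\<And>n. Y n \<in> measurable M (count_space UNIV)"
    and "partially_exchangeable M Y"
    and "\<P>(\<omega> in M. Y 0 \<omega> = y\<^sub>0) = 1"
  shows "countable_markov_mixture M Y y\<^sub>0 \<longleftrightarrow> recurrent_hmm M Y"
  using countable_mixture_imp_recurrent_hmm[OF assms] recurrent_hmm_imp_countable_mixture[OF assms]
  by blast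

end
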